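(* Let $k\ge 2$ be a natural number and let $S$ be a $k$-automatic subset of $\mathbb{N}$ (given by a DFA accepting the language of canonical base-$k$ expansions of its elements). There is an algorithm that determines whether both of the conditions (1) $S$ is not sparse and (2) $\gcd(S)=1$ hold, and, if so, also determines the smallest possible $N$ for which there exists $M$ such that every natural number $n\ge M$ can be expressed as a sum of at most $N$ elements of $S$, together with the corresponding smallest possible $M$ for this $N$.
   Context: $\mathbb{N}=\{0,1,2,\ldots\}$. The canonical base-$k$ expansion of $n\in\mathbb{N}$ is the word over $\{0,1,\ldots,k-1\}$ representing $n$ in base $k$ without leading zeros (the empty word for $n=0$). A set $S\subseteq\mathbb{N}$ is $k$-automatic if the language of canonical base-$k$ expansions of its elements is regular, i.e., accepted by a deterministic finite automaton (DFA); by convention expansions are read by automata starting with the least significant digit. Let $\pi_S(x)=\#\{n\le x : n\in S\}$. $S$ is sparse if there is an integer $d\ge 0$ with $\pi_S(x)=O((\log x)^d)$; otherwise $S$ is non-sparse. $\gcd(S)$ is the greatest common divisor of all elements of $S$. A sum of at most $N$ elements of $S$ is a sum $x_1+\cdots+x_i$ with $1\le i\le N$ and $x_1,\ldots,x_i\in S$ (repetitions allowed). The algorithm's input is $k$ and a DFA for $S$. *)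

theory Defs
  imports Complex_Main "HOL-Library.Landau_Symbols" "HOL-Library.Nat_Bijection"
begin

text \<open>
  Algorithms are Kleene's partial recursive functions. A program is applied to the list of its
  arguments; for a fixed number of arguments this is the usual definition with explicit arities
  (\<open>Prec\<close> recurses on the first argument, \<open>Mu\<close> minimizes over a new first argument and
  requires all smaller values to be defined and nonzero).
\<close>

datatype recf =
    Zero
  | Succ
  | Proj nat
  | Comp recf "recf list"
  | Prec recf recf
  | Mu recf

inductive computes :: "recf \<Rightarrow> nat list \<Rightarrow> nat \<Rightarrow> bool" where
  Zero: "computes Zero xs 0"
| Succ: "computes Succ [x] (Suc x)"
| Proj: "i < length xs \<Longrightarrow> computes (Proj i) xs (xs ! i)"
| Comp: "list_all2 (\<lambda>g y. computes g xs y) gs ys \<Longrightarrow> computes f ys z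
    \<Longrightarrow> computes (Comp f gs) xs z"
| Prec_0: "computes f xs y \<Longrightarrow> computes (Prec f g) (0 # xs) y"
| Prec_Suc: "computes (Prec f g) (n # xs) y \<Longrightarrow> computes g (n # y # xs) z
    \<Longrightarrow> computes (Prec f g) (Suc n # xs) z"
| Mu: "computes f (n # xs) 0 \<Longrightarrow> (\<And>m. m < n \<Longrightarrow> \<exists>y. computes f (m # xs) (Suc y))
    \<Longrightarrow> computes (Mu f) xs n"

inductive_cases computes_elims:
  "computes Zero xs z"
  "computes Succ xs z"
  "computes (Proj i) xs z"
  "computes (Comp f gs) xs z"
  "computes (Prec f g) (0 # xs) z"
  "computes (Prec f g) (Suc n # xs) z"
  "computes (Mu f) xs z"

lemma computes_deterministic:
  "computes p xs y \<Longrightarrow> computes p xs z \<Longrightarrow> y = z"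
proof (induction arbitrary: z rule: computes.induct)
  case (Zero xs)
  then show ?case by (auto elim: computes_elims(1))
next
  case (Succ x)
  then show ?case by (auto elim: computes_elims(2))
next
  case (Proj i xs)
  then show ?case by (auto elim: computes_elims(3))
next
  case (Comp xs gs ys f y)
  from Comp.prems obtain ys' where
    ys': "list_all2 (\<lambda>g y. computes g xs y) gs ys'" "computes f ys' z"
    by (rule computes_elims(4))
  have "ys = ys'"
    using Comp.IH(1) ys'(1) by (auto simp: list_all2_conv_all_nth intro!: nth_equalityI)
  then show ?case using Comp.IH(2) ys'(2) by blast
next
  case (Prec_0 f xs y g)
  from Prec_0.prems have "computes f xs z" by (rule computes_elims(5))
  then show ?case by (rule Prec_0.IH)
next
  case (Prec_Suc f g n xs y y')
  from Prec_Suc.prems obtain v where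
    "computes (Prec f g) (n # xs) v" "computes g (n # v # xs) z"
    by (rule computes_elims(6))
  then show ?case using Prec_Suc.IH by blast
next
  case (Mu f n xs)
  from Mu.prems have z: "computes f (z # xs) 0" "\<And>m. m < z \<Longrightarrow> \<exists>y. computes f (m # xs) (Suc y)"
    by (auto elim: computes_elims(7))
  show ?case
  proof (rule linorder_cases[of n z])
    assume "n < z"
    then obtain y where "computes f (n # xs) (Suc y)" using z(2) by blast
    then have "0 = Suc y" by (rule Mu.IH(1))
    then show ?thesis by simp
  next
    assume "z < n"
    then obtain y where "\<forall>v. computes f (z # xs) v \<longrightarrow> Suc y = v" using Mu.IH(2) by blast
    then have "Suc y = 0" using z(1) by blast
    then show ?thesis by simp
  qed
qed


text \<open>
  A DFA over the alphabet \<open>{0..<k}\<close>, given by its transition table: the states are the row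
  indices of \<open>delta\<close>, and \<open>delta ! q ! a\<close> is the successor of state \<open>q\<close> on letter \<open>a\<close>.
\<close>

record dfa =
  initial :: nat
  delta :: "nat list list"
  accepting :: "nat list"

definition dfa_over :: "nat \<Rightarrow> dfa \<Rightarrow> bool" where
  "dfa_over k A \<longleftrightarrow>
     initial A < length (delta A) \<and>
     (\<forall>row \<in> set (delta A). length row = k \<and> set row \<subseteq> {..<length (delta A)}) \<and>
     set (accepting A) \<subseteq> {..<length (delta A)}"

definition dfa_language :: "nat \<Rightarrow> dfa \<Rightarrow> nat list set" where
  "dfa_language k A =
     {w. set w \<subseteq> {..<k} \<and> fold (\<lambda>a q. delta A ! q ! a) w (initial A) \<in> set (accepting A)}"

definition dfa_code :: "dfa \<Rightarrow> nat" where
  "dfa_code A = prod_encode (initial A,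
     prod_encode (list_encode (map list_encode (delta A)), list_encode (accepting A)))"


text \<open>
  Words are written least significant digit first, so that the leading digit is the last letter.
\<close>

definition canonical_expansion :: "nat \<Rightarrow> nat \<Rightarrow> nat list \<Rightarrow> bool" where
  "canonical_expansion k n w \<longleftrightarrow>
     set w \<subseteq> {..<k} \<and> (w \<noteq> [] \<longrightarrow> last w \<noteq> 0) \<and> (\<Sum>i<length w. w ! i * k ^ i) = n"

definition automaton_for :: "nat \<Rightarrow> dfa \<Rightarrow> nat set \<Rightarrow> bool" where
  "automaton_for k A S \<longleftrightarrow>
     dfa_over k A \<and> dfa_language k A = {w. \<exists>n\<in>S. canonical_expansion k n w}"


definition counting :: "nat set \<Rightarrow> real \<Rightarrow> nat" where
  "counting S x = card {n \<in> S. real n \<le> x}"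

definition sparse :: "nat set \<Rightarrow> bool" where
  "sparse S \<longleftrightarrow> (\<exists>d::nat. (\<lambda>x. real (counting S x)) \<in> O[at_top](\<lambda>x. ln x ^ d))"

definition sums_at_most :: "nat \<Rightarrow> nat set \<Rightarrow> nat set" where
  "sums_at_most N S = {sum_list xs | xs. 1 \<le> length xs \<and> length xs \<le> N \<and> set xs \<subseteq> S}"

definition basis_from :: "nat set \<Rightarrow> nat \<Rightarrow> nat \<Rightarrow> bool" where
  "basis_from S N M \<longleftrightarrow> (\<forall>n\<ge>M. n \<in> sums_at_most N S)"

definition optimal_basis_from :: "nat set \<Rightarrow> nat \<Rightarrow> nat \<Rightarrow> bool" where
  "optimal_basis_from S N M \<longleftrightarrow>
     basis_from S N M \<and>
     (\<forall>N' M'. basis_from S N' M' \<longrightarrow> N \<le> N') \<and>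
     (\<forall>M'. basis_from S N M' \<longrightarrow> M \<le> M')"

text \<open>
  The answer \<open>None\<close> says that the set is sparse or its gcd is not 1.
\<close>

fun answer_code :: "(nat \<times> nat) option \<Rightarrow> nat" where
  "answer_code None = 0"
| "answer_code (Some (N, M)) = Suc (prod_encode (N, M))"

end

theory Submission
  imports Defs "HOL-Library.FuncSet"
begin

text \<open>
  The two conditions hold if and only if some \<open>N\<close> and \<open>M\<close> exist. If \<open>S\<close> is not sparse, then some
  state of the automaton has two distinct loops \<open>y\<close>, \<open>z\<close> of equal length, so that \<open>S\<close> contains the
  numbers with expansion \<open>u w v\<close>, \<open>w\<close> in \<open>{y, z}\<^sup>*\<close>; boundedly many of them sum up to every large multiple of
  some \<open>E\<close>, and the residues modulo \<open>E\<close> are supplied by \<open>gcd S = 1\<close>. All of this is explicit,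
  which bounds the least \<open>N\<close> in terms of the automaton. Conversely, a sparse set has too few sums.

  For fixed \<open>N\<close>, the set \<open>T\<close> of sums has at most \<open>b\<close> sections \<open>{n. n k\<^sup>i + j \<in> T}\<close>, \<open>j < k\<^sup>i\<close>, where \<open>b\<close>
  is computable. By pumping, \<open>T\<close> is cofinite if and only if it contains all numbers from \<open>k\<^sup>b\<close> up to
  \<open>k\<^sup>2\<^sup>b\<close>, and then it contains all numbers from \<open>k\<^sup>b\<close> on. So the algorithm only needs bounded searches.
\<close>

section \<open>Computable functions\<close>

text \<open>Neither sparsity nor the gcd is tested. The search for \<open>N\<close> stops at a limit
  computed from \<open>k\<close> and the code of the automaton, and passing this limit certifies
  that one of the two conditions fails. This is why the construction from two loops has to be
  quantitative, down to the lengths of the loops and of the words around them. No automaton for the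
  sumset is built either: pumping needs only a bound on the number of its sections, and such a
  section depends on the residues of the summands only through the list of their sections and the
  carry. Exchanging one loop for the other changes a number by a multiple of \<open>E\<close>, the
  difference of the two loop values shifted by the length of the prefix; this is the origin of
  \<open>E\<close>, and it is why residues have to come from the gcd. All limits are crude, as only
  computability matters: the code of the automaton stands in for its number of states.\<close>

definition recursive :: "('a \<Rightarrow> nat list) \<Rightarrow> ('a \<Rightarrow> nat) \<Rightarrow> bool" where
  "recursive E f \<longleftrightarrow> (\<exists>p. \<forall>x. computes p (E x) (f x))"

lemma recursive_reindex: "recursive E f \<Longrightarrow> recursive (\<lambda>x. E (h x)) (\<lambda>x. f (h x))"
  unfolding recursive_def by blast

lemma recursive_nth: "(\<And>x. i < length (E x)) \<Longrightarrow> recursive E (\<lambda>x. E x ! i)"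
  unfolding recursive_def by (intro exI[of _ "Proj i"] allI computes.Proj)

lemma recursive_zero: "recursive E (\<lambda>_. 0)"
  unfolding recursive_def by (intro exI[of _ Zero] allI computes.Zero)

lemma recursive_comp1:
  assumes "recursive (\<lambda>n. [n]) h" "recursive E f"
  shows "recursive E (\<lambda>x. h (f x))"
proof -
  obtain p q where "\<And>n. computes p [n] (h n)" "\<And>x. computes q (E x) (f x)"
    using assms unfolding recursive_def by blast
  then have "computes (Comp p [q]) (E x) (h (f x))" for x
    by (intro computes.Comp[where ys = "[f x]"]) auto
  then show ?thesis unfolding recursive_def by blast
qed

lemma recursive_comp2:
  assumes "recursive (\<lambda>(m, n). [m, n]) (\<lambda>(m, n). h m n)" "recursive E f" "recursive E g"
  shows "recursive E (\<lambda>x. h (f x) (g x))"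
proof -
  obtain p q r where "\<And>m n. computes p [m, n] (h m n)"
    "\<And>x. computes q (E x) (f x)" "\<And>x. computes r (E x) (g x)"
    using assms unfolding recursive_def by fastforce
  then have "computes (Comp p [q, r]) (E x) (h (f x) (g x))" for x
    by (intro computes.Comp[where ys = "[f x, g x]"]) auto
  then show ?thesis unfolding recursive_def by blast
qed

lemma recursive_Suc:
  assumes "recursive E f"
  shows "recursive E (\<lambda>x. Suc (f x))"
proof (rule recursive_comp1[OF _ assms])
  show "recursive (\<lambda>n. [n]) Suc"
    unfolding recursive_def by (intro exI[of _ Succ] allI computes.Succ)
qed

lemma recursive_const: "recursive E (\<lambda>_. n)"
  by (induction n) (auto intro: recursive_zero recursive_Suc)

lemma computes_Prec:
  assumes "computes p xs a"
    and "\<And>i. i < n \<Longrightarrow> computes q (i # rec_nat a g i # xs) (g i (rec_nat a g i))"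
  shows "computes (Prec p q) (n # xs) (rec_nat a g n)"
  using assms(2) by (induction n) (auto intro: computes.intros assms(1))

lemma recursive_rec_nat:
  assumes "recursive E f" "recursive (\<lambda>(m, y, x). m # y # E x) (\<lambda>(m, y, x). g m y x)"
  shows "recursive (\<lambda>(n, x). n # E x) (\<lambda>(n, x). rec_nat (f x) (\<lambda>m y. g m y x) n)"
proof -
  obtain p q where "\<And>x. computes p (E x) (f x)"
    "\<And>m y x. computes q (m # y # E x) (g m y x)"
    using assms unfolding recursive_def by fastforce
  then have "computes (Prec p q) (n # E x) (rec_nat (f x) (\<lambda>m y. g m y x) n)" for n x
    by (intro computes_Prec)
  then show ?thesis unfolding recursive_def by fastforce
qed

lemma recursive_rec_nat_unary:
  assumes "recursive (\<lambda>(m, y). [m, y]) (\<lambda>(m, y). g m y)"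
  shows "recursive (\<lambda>n. [n]) (\<lambda>n. rec_nat a g n)"
proof -
  have "recursive (\<lambda>(m, y, x::unit). m # y # []) (\<lambda>(m, y, x). g m y)"
    using recursive_reindex[OF assms, of "\<lambda>(m, y, x). (m, y)"] by (simp add: case_prod_beta')
  from recursive_reindex[OF recursive_rec_nat[OF recursive_const[of _ a] this], of "\<lambda>n. (n, ())"]
  show ?thesis by simp
qed

lemma recursive_fst_arg: "recursive (\<lambda>(m, n). m # E n) (\<lambda>(m, n). m)"
  using recursive_nth[of 0 "\<lambda>(m, n). m # E n"] by (simp add: case_prod_beta')

lemma recursive_snd_arg: "recursive (\<lambda>(m, n). m # n # E' m n) (\<lambda>(m, n). n)"
  using recursive_nth[of 1 "\<lambda>(m, n). m # n # E' m n"] by (simp add: case_prod_beta')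

lemma recursive_add:
  assumes "recursive E f" "recursive E g"
  shows "recursive E (\<lambda>x. f x + g x)"
proof (rule recursive_comp2[OF _ assms])
  have "recursive (\<lambda>(m, y, x::nat). m # y # [x]) (\<lambda>(m, y, x). Suc y)"
    using recursive_Suc[OF recursive_nth[of 1 "\<lambda>(m, y, x::nat). m # y # [x]"]]
    by (simp add: case_prod_beta')
  moreover have "recursive (\<lambda>x. [x]) (\<lambda>x. x)" using recursive_nth[of 0 "\<lambda>x. [x]"] by simp
  moreover have "rec_nat x (\<lambda>m y. Suc y) n = n + x" for n x by (induction n) auto
  ultimately show "recursive (\<lambda>(m, n). [m, n]) (\<lambda>(m, n). m + n)"
    using recursive_rec_nat[of "\<lambda>x. [x]" "\<lambda>x. x" "\<lambda>m y x. Suc y"] by simp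
qed

lemma recursive_pred:
  assumes "recursive E f"
  shows "recursive E (\<lambda>x. f x - 1)"
proof (rule recursive_comp1[OF _ assms])
  have "rec_nat 0 (\<lambda>m y. m) n = n - 1" for n :: nat by (cases n) auto
  then show "recursive (\<lambda>n. [n]) (\<lambda>n. n - 1)"
    using recursive_rec_nat_unary[OF recursive_fst_arg[of "\<lambda>y. [y]"], of 0] by simp
qed

lemma recursive_diff:
  assumes "recursive E f" "recursive E g"
  shows "recursive E (\<lambda>x. f x - g x)"
\<comment> \<open>\<open>Prec\<close> recurses on its first argument, so the subtrahend has to come
  first.\<close>
proof (rule recursive_comp2[OF _ assms(2,1), of "\<lambda>n m. m - n"])
  have "recursive (\<lambda>(m, y, x::nat). m # y # [x]) (\<lambda>(m, y, x). y - 1)"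
    using recursive_pred[OF recursive_nth[of 1 "\<lambda>(m, y, x::nat). m # y # [x]"]]
    by (simp add: case_prod_beta')
  moreover have "recursive (\<lambda>x. [x]) (\<lambda>x. x)" using recursive_nth[of 0 "\<lambda>x. [x]"] by simp
  moreover have "rec_nat x (\<lambda>m y. y - 1) n = x - n" for n x :: nat by (induction n) auto
  ultimately show "recursive (\<lambda>(m, n). [m, n]) (\<lambda>(m, n). n - m)"
    using recursive_rec_nat[of "\<lambda>x. [x]" "\<lambda>x. x" "\<lambda>m y x. y - 1"] by simp
qed

lemma recursive_triangle:
  assumes "recursive E f"
  shows "recursive E (\<lambda>x. triangle (f x))"
proof (rule recursive_comp1[OF _ assms])
  have "recursive (\<lambda>(m, y). [m, y]) (\<lambda>(m, y). y + Suc m)"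
    using recursive_add[OF recursive_snd_arg[of "\<lambda>_ _. []"]
        recursive_Suc[OF recursive_fst_arg[of "\<lambda>y. [y]"]]] by (simp add: case_prod_beta')
  moreover have "rec_nat 0 (\<lambda>m y. y + Suc m) n = triangle n" for n by (induction n) auto
  ultimately show "recursive (\<lambda>n. [n]) triangle"
    using recursive_rec_nat_unary[of "\<lambda>m y. y + Suc m" 0] by simp
qed

lemma recursive_prod_encode:
  assumes "recursive E f" "recursive E g"
  shows "recursive E (\<lambda>x. prod_encode (f x, g x))"
  unfolding prod_encode_def using assms
  by (auto intro!: recursive_add recursive_triangle)

lemma computes_prod_encode: "\<exists>p. \<forall>m n. computes p [m, n] (prod_encode (m, n))"
proof -
  have "recursive (\<lambda>(m, n). [m, n]) (\<lambda>(m, n). prod_encode (m, n))"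
    unfolding case_prod_beta'
    using recursive_fst_arg[of "\<lambda>x. [x]"] recursive_snd_arg[of "\<lambda>_ _. []"]
    by (intro recursive_prod_encode) (auto simp: case_prod_beta')
  then show ?thesis unfolding recursive_def by fastforce
qed

text \<open>The largest \<open>w\<close> with \<open>triangle w \<le> z\<close>. It grows by at most
  one when \<open>z\<close> does, so primitive recursion computes it; the nested truncated
  differences are the 0/1 value of \<open>triangle (Suc w) \<le> Suc z\<close>.\<close>

definition triangle_root :: "nat \<Rightarrow> nat" where
  "triangle_root = rec_nat 0 (\<lambda>z w. w + (1 - (triangle (Suc w) - Suc z)))"

lemma triangle_root_Suc:
  "triangle_root (Suc z) = (if triangle (Suc (triangle_root z)) \<le> Suc z
    then Suc (triangle_root z) else triangle_root z)"
  by (simp add: triangle_root_def)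

lemma triangle_root_bounds: "triangle (triangle_root z) \<le> z \<and> z < triangle (Suc (triangle_root z))"
proof (induction z)
  case (Suc z)
  then show ?case unfolding triangle_root_Suc by (auto simp del: One_nat_def)
qed (simp add: triangle_root_def)

text \<open>A pair \<open>(m, n)\<close> has code \<open>triangle (m + n) + m\<close>, so the
  triangle root recovers \<open>m + n\<close> and the remainder is \<open>m\<close>.\<close>

lemma prod_decode_eq_triangle_root:
  "prod_decode z = (z - triangle (triangle_root z), triangle_root z - (z - triangle (triangle_root z)))"
proof -
  let ?w = "triangle_root z"
  have "prod_decode z = prod_decode_aux ?w (z - triangle ?w)"
    using prod_decode_triangle_add[of ?w "z - triangle ?w"] triangle_root_bounds[of z] by simp
  moreover have "z - triangle ?w \<le> ?w" using triangle_root_bounds[of z] by auto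
  ultimately show ?thesis by (simp add: prod_decode_aux.simps)
qed

lemma recursive_prod_decode:
  assumes "recursive E f"
  shows "recursive E (\<lambda>x. fst (prod_decode (f x)))" "recursive E (\<lambda>x. snd (prod_decode (f x)))"
proof -
  have "recursive (\<lambda>(m, y). [m, y]) (\<lambda>(m, y). y + (1 - (triangle (Suc y) - Suc m)))"
    unfolding case_prod_beta'
    using recursive_snd_arg[of "\<lambda>_ _. []"] recursive_fst_arg[of "\<lambda>y. [y]"]
    by (intro recursive_add recursive_diff recursive_const recursive_triangle recursive_Suc)
      (auto simp: case_prod_beta')
  from recursive_rec_nat_unary[OF this] have "recursive (\<lambda>n. [n]) triangle_root"
    unfolding triangle_root_def .
  from recursive_comp1[OF this assms] show
    "recursive E (\<lambda>x. fst (prod_decode (f x)))" "recursive E (\<lambda>x. snd (prod_decode (f x)))"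
    unfolding prod_decode_eq_triangle_root fst_conv snd_conv
    by (intro recursive_diff recursive_triangle assms; assumption)+
qed

section \<open>Computability for structured data\<close>

class code =
  fixes enc :: "'a \<Rightarrow> nat"

instantiation nat :: code begin
definition enc_nat :: "nat \<Rightarrow> nat" where [simp]: "enc_nat n = n"
instance ..
end

instantiation bool :: code begin
definition enc_bool :: "bool \<Rightarrow> nat" where [simp]: "enc_bool b = of_bool b"
instance ..
end

instantiation prod :: (code, code) code begin
definition enc_prod :: "'a \<times> 'b \<Rightarrow> nat" where
  enc_prod [simp]: "enc_prod z = prod_encode (enc (fst z), enc (snd z))"
instance ..
end

instantiation list :: (code) code begin
definition enc_list :: "'a list \<Rightarrow> nat" where "enc_list xs = list_encode (map enc xs)"
instance ..
end

lemma enc_list_simps [simp]: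
  "enc [] = 0" "enc (x # xs) = Suc (prod_encode (enc x, enc xs))"
  by (simp_all add: enc_list_def)

text \<open>One number codes the whole argument. The rules below take functions with parameters in
  uncurried form, the parameters being nested pairs, so that \<open>intro computable\<close> can
  assemble programs along the syntax of a term.\<close>

definition computable :: "('a::code \<Rightarrow> 'b::code) \<Rightarrow> bool" where
  "computable f \<longleftrightarrow> recursive (\<lambda>x. [enc x]) (\<lambda>x. enc (f x))"

named_theorems computable

lemma computable_cong: "computable f \<Longrightarrow> (\<And>x. f x = g x) \<Longrightarrow> computable g"
  by (metis ext)

lemma computable_id [computable]: "computable (\<lambda>x. x)"
  unfolding computable_def using recursive_nth[of 0 "\<lambda>x. [enc x]"] by simp

lemma computable_const [computable]: "computable (\<lambda>_. c)"
  unfolding computable_def by (rule recursive_const)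

lemma computable_comp: "computable h \<Longrightarrow> computable f \<Longrightarrow> computable (\<lambda>x. h (f x))"
proof -
  assume "computable h" "computable f"
  then obtain p q where "\<And>y. computes p [enc y] (enc (h y))" "\<And>x. computes q [enc x] (enc (f x))"
    unfolding computable_def recursive_def by blast
  then have "computes (Comp p [q]) [enc x] (enc (h (f x)))" for x
    by (intro computes.Comp[where ys = "[enc (f x)]"]) auto
  then show ?thesis unfolding computable_def recursive_def by blast
qed

lemma computable_enc [computable]: "computable f \<Longrightarrow> computable (\<lambda>x. enc (f x))"
  by (simp add: computable_def)

lemma computable_Pair [computable]:
  "computable f \<Longrightarrow> computable g \<Longrightarrow> computable (\<lambda>x. (f x, g x))"
  unfolding computable_def by (simp add: recursive_prod_encode)

lemma computable_fst [computable]: "computable f \<Longrightarrow> computable (\<lambda>x. fst (f x))"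
  unfolding computable_def using recursive_prod_decode(1)[where f = "\<lambda>x. enc (f x)"] by simp

lemma computable_snd [computable]: "computable f \<Longrightarrow> computable (\<lambda>x. snd (f x))"
  unfolding computable_def using recursive_prod_decode(2)[where f = "\<lambda>x. enc (f x)"] by simp

lemma computable_Suc [computable]: "computable f \<Longrightarrow> computable (\<lambda>x. Suc (f x))"
  unfolding computable_def by (simp add: recursive_Suc)

lemma computable_add [computable]:
  "computable f \<Longrightarrow> computable g \<Longrightarrow> computable (\<lambda>x. f x + g x :: nat)"
  unfolding computable_def by (simp add: recursive_add)

lemma computable_diff [computable]:
  "computable f \<Longrightarrow> computable g \<Longrightarrow> computable (\<lambda>x. f x - g x :: nat)"
  unfolding computable_def by (simp add: recursive_diff)

lemma computable_rec_nat [computable]: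
  assumes "computable n" "computable f"
    and "computable (\<lambda>z. g (fst z) (fst (snd z)) (snd (snd z)))"
  shows "computable (\<lambda>x. rec_nat (f x) (\<lambda>m y. g m y x) (n x))"
proof -
  obtain pn pf pg where p: "\<And>x. computes pn [enc x] (n x)"
    "\<And>x. computes pf [enc x] (enc (f x))"
    "\<And>m y x. computes pg [prod_encode (m, prod_encode (enc y, enc x))] (enc (g m y x))"
    using assms unfolding computable_def recursive_def by fastforce
  \<comment> \<open>\<open>Prec\<close> hands three separate numbers to its step, whereas
    \<open>pg\<close> expects the code of a triple; \<open>pp\<close> does the packing.\<close>
  have "recursive (\<lambda>(m, y, x::nat). [m, y, x]) (\<lambda>(m, y, x). prod_encode (m, prod_encode (y, x)))"
    unfolding case_prod_beta'
    using recursive_nth[of 0 "\<lambda>(m, y, x::nat). [m, y, x]"]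
      recursive_nth[of 1 "\<lambda>(m, y, x::nat). [m, y, x]"]
      recursive_nth[of 2 "\<lambda>(m, y, x::nat). [m, y, x]"]
    by (intro recursive_prod_encode) (auto simp: case_prod_beta')
  then obtain pp where pp: "\<And>m y x. computes pp [m, y, x] (prod_encode (m, prod_encode (y, x)))"
    unfolding recursive_def by fastforce
  have "computes (Prec pf (Comp pg [pp])) [m, enc x] (enc (rec_nat (f x) (\<lambda>m y. g m y x) m))" for m x
  proof (induction m)
    case 0
    then show ?case by (simp add: computes.Prec_0 p)
  next
    case (Suc m)
    then show ?case
      by (auto intro!: computes.Prec_Suc computes.Comp[where ys = "[_]"] pp p)
  qed
  then have "computes (Comp (Prec pf (Comp pg [pp])) [pn, Proj 0]) [enc x]
      (enc (rec_nat (f x) (\<lambda>m y. g m y x) (n x)))" for x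
    using computes.Proj[of 0 "[enc x]"]
    by (intro computes.Comp[where ys = "[n x, enc x]"]) (auto intro: p)
  then show ?thesis unfolding computable_def recursive_def by blast
qed

text \<open>A Boolean is coded by 0 or 1, so a branch is a recursion of at most one step.\<close>

lemma computable_if [computable]:
  assumes "computable c" "computable f" "computable g"
  shows "computable (\<lambda>x. if c x then f x else g x)"
proof -
  have c: "computable (\<lambda>x. enc (c x))" using assms(1) by (simp add: computable_def)
  have "computable (\<lambda>x. rec_nat (g x) (\<lambda>m y. f x) (enc (c x)))"
    by (intro computable c assms computable_comp[OF assms(2)])
  moreover have "rec_nat (g x) (\<lambda>m y. f x) (enc (c x)) = (if c x then f x else g x)" for x
    by simp
  ultimately show ?thesis by simp
qed

lemma computable_not [computable]: "computable P \<Longrightarrow> computable (\<lambda>x. \<not> P x)"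
  by (rule computable_cong[OF computable_if[of P "\<lambda>_. False" "\<lambda>_. True"]]) (auto intro: computable_const)

lemma computable_conj [computable]:
  "computable P \<Longrightarrow> computable Q \<Longrightarrow> computable (\<lambda>x. P x \<and> Q x)"
  by (rule computable_cong[OF computable_if[of P Q "\<lambda>_. False"]]) (auto intro: computable_const)

lemma computable_disj [computable]:
  "computable P \<Longrightarrow> computable Q \<Longrightarrow> computable (\<lambda>x. P x \<or> Q x)"
  by (rule computable_cong[OF computable_if[of P "\<lambda>_. True" Q]]) (auto intro: computable_const)

lemma computable_imp [computable]:
  "computable P \<Longrightarrow> computable Q \<Longrightarrow> computable (\<lambda>x. P x \<longrightarrow> Q x)"
  unfolding imp_conv_disj by (intro computable)

lemma computable_eq_0: "computable f \<Longrightarrow> computable (\<lambda>x. f x = (0::nat))"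
proof -
  assume "computable f"
  then have "computable (\<lambda>x. rec_nat True (\<lambda>_ _. False) (f x))" by (intro computable)
  moreover have "rec_nat True (\<lambda>_ _. False) n \<longleftrightarrow> n = 0" for n by (cases n) auto
  ultimately show ?thesis by simp
qed

lemma computable_le [computable]:
  "computable f \<Longrightarrow> computable g \<Longrightarrow> computable (\<lambda>x. f x \<le> (g x :: nat))"
  using computable_eq_0[OF computable_diff[of f g]] by simp

lemma computable_less [computable]:
  "computable f \<Longrightarrow> computable g \<Longrightarrow> computable (\<lambda>x. f x < (g x :: nat))"
  using computable_le[OF computable_Suc[of f], of g] by (simp add: Suc_le_eq)

lemma computable_eq [computable]:
  "computable f \<Longrightarrow> computable g \<Longrightarrow> computable (\<lambda>x. f x = (g x :: nat))"
  unfolding eq_iff by (intro computable)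

lemma computable_mult [computable]:
  assumes "computable f" "computable g"
  shows "computable (\<lambda>x. f x * g x :: nat)"
proof -
  have "computable (\<lambda>x. rec_nat 0 (\<lambda>m y. y + g x) (f x))"
    by (intro computable assms computable_comp[OF assms(2)])
  moreover have "rec_nat 0 (\<lambda>m y. y + b) a = a * b" for a b :: nat by (induction a) auto
  ultimately show ?thesis by simp
qed

lemma computable_power [computable]:
  assumes "computable f" "computable g"
  shows "computable (\<lambda>x. f x ^ g x :: nat)"
proof -
  have "computable (\<lambda>x. rec_nat 1 (\<lambda>m y. y * f x) (g x))"
    by (intro computable assms computable_comp[OF assms(1)])
  moreover have "rec_nat 1 (\<lambda>m y. y * b) a = b ^ a" for a b :: nat by (induction a) auto
  ultimately show ?thesis by simp
qed

lemma computable_mod [computable]: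
  assumes "computable f" "computable g"
  shows "computable (\<lambda>x. f x mod g x :: nat)"
proof -
  have "computable (\<lambda>x. rec_nat 0 (\<lambda>m y. if Suc y = g x then 0 else Suc y) (f x))"
    by (intro computable assms computable_comp[OF assms(2)])
  moreover have "rec_nat 0 (\<lambda>m y. if Suc y = b then 0 else Suc y) a = a mod b" for a b :: nat
    by (induction a) (auto simp: mod_Suc)
  ultimately show ?thesis by simp
qed

lemma computable_div [computable]:
  assumes "computable f" "computable g"
  shows "computable (\<lambda>x. f x div g x :: nat)"
proof -
  have "computable (\<lambda>x. rec_nat 0 (\<lambda>m y. if Suc (m mod g x) = g x then Suc y else y) (f x))"
    by (intro computable assms computable_comp[OF assms(2)])
  moreover have "rec_nat 0 (\<lambda>m y. if Suc (m mod b) = b then Suc y else y) a = a div b" for a b :: nat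
    by (induction a) (auto simp: div_Suc mod_Suc)
  ultimately show ?thesis by simp
qed

lemma computable_ex_less [computable]:
  fixes n :: "'a::code \<Rightarrow> nat"
  assumes "computable n" "computable (\<lambda>z. P (fst z) (snd z))"
  shows "computable (\<lambda>x. \<exists>i::nat<n x. P i x)"
proof -
  have "computable (\<lambda>z :: nat \<times> bool \<times> 'a. P (fst z) (snd (snd z)))"
    using computable_comp[OF assms(2), of "\<lambda>z. (fst z, snd (snd z))"] by (simp add: computable)
  then have "computable (\<lambda>x. rec_nat False (\<lambda>m y. y \<or> P m x) (n x))"
    by (intro computable assms)
  moreover have "rec_nat False (\<lambda>m y. y \<or> Q m) k = (\<exists>i<k. Q i)" for Q k
    by (induction k) (auto simp: less_Suc_eq)
  ultimately show ?thesis by simp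
qed

lemma computable_all_less [computable]:
  assumes "computable n" "computable (\<lambda>z. P (fst z) (snd z))"
  shows "computable (\<lambda>x. \<forall>i::nat<n x. P i x)"
  using computable_not[OF computable_ex_less[OF assms(1) computable_not[OF assms(2)]]] by simp

text \<open>The only place where \<open>Mu\<close> enters; a witness for every argument makes the
  search total. As \<open>Mu\<close> looks for a zero, the program searched is the 0/1 value of the
  negated predicate.\<close>

lemma computable_Least [computable]:
  assumes "computable (\<lambda>z. P (fst z) (snd z))" "\<And>x. \<exists>i::nat. P i x"
  shows "computable (\<lambda>x. LEAST i. P i x)"
proof -
  obtain q where q: "\<And>i x. computes q [prod_encode (i, enc x)] (of_bool (\<not> P i x))"
    using computable_not[OF assms(1)] unfolding computable_def recursive_def by fastforce
  obtain pp where "\<And>m n. computes pp [m, n] (prod_encode (m, n))"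
    using computes_prod_encode by blast
  with q have q': "computes (Comp q [pp]) [i, enc x] (of_bool (\<not> P i x))" for i x
    by (intro computes.Comp[where ys = "[prod_encode (i, enc x)]"]) auto
  have "computes (Mu (Comp q [pp])) [enc x] (LEAST i. P i x)" for x
  proof (rule computes.Mu)
    show "computes (Comp q [pp]) [LEAST i. P i x, enc x] 0"
      using q'[of "LEAST i. P i x" x] LeastI_ex[OF assms(2)[of x]] by simp
  next
    fix m assume "m < (LEAST i. P i x)"
    then have "\<not> P m x" by (rule not_less_Least)
    then show "\<exists>y. computes (Comp q [pp]) [m, enc x] (Suc y)"
      using q'[of m x] by auto
  qed
  then show ?thesis unfolding computable_def recursive_def by auto
qed

lemma computable_funpow [computable]:
  fixes a :: "'a::code \<Rightarrow> 'b::code" and f :: "'a \<Rightarrow> 'b \<Rightarrow> 'b"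
  assumes "computable n" "computable a" "computable (\<lambda>z. f (fst z) (snd z))"
  shows "computable (\<lambda>x. (f x ^^ n x) (a x))"
proof -
  have "computable (\<lambda>z :: nat \<times> 'b \<times> 'a. f (snd (snd z)) (fst (snd z)))"
    using computable_comp[OF assms(3), of "\<lambda>z. (snd (snd z), fst (snd z))"] by (simp add: computable)
  then have "computable (\<lambda>x. rec_nat (a x) (\<lambda>m y. f x y) (n x))"
    by (intro computable assms)
  moreover have "rec_nat b (\<lambda>m y. g y) k = (g ^^ k) b" for g :: "'b \<Rightarrow> 'b" and b k
    by (induction k) auto
  ultimately show ?thesis by simp
qed

text \<open>A list is nonempty iff its code is positive, so the case distinction is a recursion on
  the bit \<open>1 - (1 - enc (l x))\<close>. The program \<open>pb\<close> is known to halt only on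
  genuine codes; the recursion runs it only in the nonempty case, where the code minus one splits
  into head and tail.\<close>

lemma computable_case_list [computable]:
  assumes "computable l" "computable a"
    and "computable (\<lambda>z. b (fst z) (fst (snd z)) (snd (snd z)))"
  shows "computable (\<lambda>x. case l x of [] \<Rightarrow> a x | y # ys \<Rightarrow> b y ys x)"
proof -
  obtain pl pa pb where p: "\<And>x. computes pl [enc x] (enc (l x))"
    "\<And>x. computes pa [enc x] (enc (a x))"
    "\<And>y ys x. computes pb [prod_encode (enc y, prod_encode (enc ys, enc x))] (enc (b y ys x))"
    using assms unfolding computable_def recursive_def by fastforce
  define F where "F c e = prod_encode (fst (prod_decode (c - 1)),
    prod_encode (snd (prod_decode (c - 1)), e))" for c e
  have "recursive (\<lambda>(i, v, (c, e::nat)). [i, v, c, e]) (\<lambda>(i, v, (c, e)). F c e)"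
    unfolding case_prod_beta' F_def
    using recursive_nth[of 2 "\<lambda>(i, v, (c, e::nat)). [i, v, c, e]"]
      recursive_nth[of 3 "\<lambda>(i, v, (c, e::nat)). [i, v, c, e]"]
    by (intro recursive_prod_encode recursive_prod_decode recursive_pred)
      (auto simp: case_prod_beta')
  then obtain pp where pp: "\<And>i v c e. computes pp [i, v, c, e] (F c e)"
    unfolding recursive_def by fastforce
  have "recursive (\<lambda>n. [n]) (\<lambda>n. 1 - (1 - n))"
    using recursive_nth[of 0 "\<lambda>n. [n]"] by (intro recursive_diff recursive_const) auto
  then obtain ps where ps: "\<And>n. computes ps [n] (1 - (1 - n))"
    unfolding recursive_def by blast
  let ?q = "Prec (Comp pa [Proj 1]) (Comp pb [pp])"
  have q: "computes ?q [1 - (1 - enc (l x)), enc (l x), enc x]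
      (enc (case l x of [] \<Rightarrow> a x | y # ys \<Rightarrow> b y ys x))" for x
  proof -
    have a: "computes (Comp pa [Proj 1]) [enc (l x), enc x] (enc (a x))"
      using computes.Proj[of 1 "[enc (l x), enc x]"]
      by (intro computes.Comp[where ys = "[enc x]"]) (auto intro: p)
    show ?thesis
    proof (cases "l x")
      case Nil
      then show ?thesis using a by (auto intro: computes.Prec_0)
    next
      case (Cons y ys)
      have "computes (Comp pb [pp]) [0, enc (a x), enc (l x), enc x] (enc (b y ys x))"
        using p(3)[of y ys x] pp[of 0 "enc (a x)" "enc (l x)" "enc x"]
        by (intro computes.Comp[where ys = "[F (enc (l x)) (enc x)]"]) (auto simp: F_def Cons)
      then show ?thesis using computes.Prec_Suc[OF computes.Prec_0[OF a]] Cons by simp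
    qed
  qed
  have "computes (Comp ?q [Comp ps [pl], pl, Proj 0]) [enc x]
      (enc (case l x of [] \<Rightarrow> a x | y # ys \<Rightarrow> b y ys x))" for x
    using q[of x] p(1)[of x] ps[of "enc (l x)"] computes.Proj[of 0 "[enc x]"]
    by (intro computes.Comp[where ys = "[1 - (1 - enc (l x)), enc (l x), enc x]"])
      (auto intro!: computes.Comp[where ys = "[enc (l x)]"])
  then show ?thesis unfolding computable_def recursive_def by blast
qed

lemma length_le_enc: "length xs \<le> enc (xs :: 'a::code list)"
  by (induction xs) (auto intro: order_trans[OF _ le_prod_encode_2])

lemma computable_fold [computable]:
  assumes "computable l" "computable a"
    and "computable (\<lambda>z. g (fst z) (fst (snd z)) (snd (snd z)))"
  shows "computable (\<lambda>x. fold (g x) (l x) (a x))"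
proof -
  \<comment> \<open>\<open>step\<close> is stationary once the list is used up, so every number of
    iterations from the length on gives the fold. The code of the list is such a number, which
    avoids computing the length beforehand.\<close>
  define step where "step x s = (case fst s of [] \<Rightarrow> s | y # ys \<Rightarrow> (ys, g x y (snd s)))" for x s
  have step: "snd ((step x ^^ n) (ys, v)) = fold (g x) ys v" if "length ys \<le> n" for x n ys v
    using that
  proof (induction n arbitrary: ys v)
    case (Suc n)
    then show ?case
      by (cases ys) (auto simp: step_def funpow_Suc_right simp del: funpow.simps(2))
  qed simp
  have l: "computable (\<lambda>x. enc (l x))" using assms(1) by (simp add: computable_def)
  have "computable (\<lambda>z. g (fst (snd (snd z))) (fst z) (snd (snd (snd (snd z)))))"
    using computable_comp[OF assms(3), of "\<lambda>z. (fst (snd (snd z)), fst z, snd (snd (snd (snd z))))"]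
    by (simp add: computable)
  then have "computable (\<lambda>z. step (fst z) (snd z))"
    unfolding step_def by (intro computable)
  then have "computable (\<lambda>x. snd ((step x ^^ enc (l x)) (l x, a x)))"
    by (intro computable l assms)
  then show ?thesis by (simp add: step length_le_enc)
qed

lemma computable_tl [computable]: "computable l \<Longrightarrow> computable (\<lambda>x. tl (l x))"
  unfolding tl_def by (intro computable)

lemma drop_eq_funpow_tl: "drop n xs = (tl ^^ n) xs"
  by (induction n arbitrary: xs) (simp_all add: drop_Suc funpow_Suc_right del: funpow.simps(2))

lemma computable_drop [computable]:
  "computable n \<Longrightarrow> computable l \<Longrightarrow> computable (\<lambda>x. drop (n x) (l x))"
  unfolding drop_eq_funpow_tl by (intro computable)

lemma computable_length [computable]:
  fixes l :: "'a::code \<Rightarrow> 'b::code list"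
  assumes "computable l" shows "computable (\<lambda>x. length (l x))"
proof -
  from assms have "computable (\<lambda>x. fold (\<lambda>_ n. Suc n) (l x) 0)" by (intro computable)
  moreover have "fold (\<lambda>_ n. Suc n) xs k = length xs + k" for xs :: "'b list" and k
    by (induction xs arbitrary: k) auto
  ultimately show ?thesis by simp
qed

lemma computable_sum_list [computable]:
  assumes "computable l" shows "computable (\<lambda>x. sum_list (l x) :: nat)"
proof -
  have "computable (\<lambda>x. fold (\<lambda>y n. n + y) (l x) 0)" by (intro computable assms)
  moreover have "fold (\<lambda>y n. n + y) xs k = k + sum_list xs" for xs :: "nat list" and k
    by (induction xs arbitrary: k) auto
  ultimately show ?thesis by simp
qed

lemma computable_ball_list [computable]:
  assumes "computable l" "computable (\<lambda>z. P (fst z) (snd z))"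
  shows "computable (\<lambda>x. \<forall>y\<in>set (l x). P x y)"
proof -
  have "computable (\<lambda>z. P (fst z) (fst (snd z)))"
    using computable_comp[OF assms(2), of "\<lambda>z. (fst z, fst (snd z))"] by (simp add: computable)
  then have "computable (\<lambda>x. fold (\<lambda>y b. b \<and> P x y) (l x) True)"
    by (intro computable assms)
  moreover have "fold (\<lambda>y b. b \<and> Q y) xs c \<longleftrightarrow> c \<and> (\<forall>y\<in>set xs. Q y)" for xs :: "'b list" and Q c
    by (induction xs arbitrary: c) auto
  ultimately show ?thesis by simp
qed

lemma computable_mem_list [computable]:
  "computable f \<Longrightarrow> computable l \<Longrightarrow> computable (\<lambda>x. f x \<in> set (l x :: nat list))"
  using computable_not[OF computable_ball_list[of l "\<lambda>x y. f x \<noteq> y"]]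
  by (simp add: computable computable_comp[of f fst])

text \<open>On codes, decoding a list of numbers is the identity.\<close>

lemma computable_list_decode [computable]:
  "computable f \<Longrightarrow> computable (\<lambda>x. list_decode (f x))"
proof -
  have "map enc xs = xs" for xs :: "nat list" by (simp add: map_idI)
  then have "enc (list_decode n) = n" for n by (simp add: enc_list_def)
  then show "computable f \<Longrightarrow> computable (\<lambda>x. list_decode (f x))"
    unfolding computable_def by simp
qed

lemma computable_prod_encode [computable]:
  "computable f \<Longrightarrow> computable g \<Longrightarrow> computable (\<lambda>x. prod_encode (f x, g x))"
  using computable_Pair[of f g] by (simp add: computable_def)

section \<open>The algorithm\<close>

text \<open>Agrees with \<open>t ! q ! a\<close> inside the table; the default 0 gives it a definite
  value everywhere, as computability requires.\<close>

definition table_lookup :: "nat list list \<Rightarrow> nat \<Rightarrow> nat \<Rightarrow> nat" where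
  "table_lookup t q a = (case drop q t of [] \<Rightarrow> 0 | row # _ \<Rightarrow>
     (case drop a row of [] \<Rightarrow> 0 | r # _ \<Rightarrow> r))"

lemma table_lookup: "q < length t \<Longrightarrow> a < length (t ! q) \<Longrightarrow> table_lookup t q a = t ! q ! a"
  by (simp add: table_lookup_def flip: Cons_nth_drop_Suc)

type_synonym table = "nat \<times> nat list list \<times> nat list"

definition run_step :: "nat \<Rightarrow> table \<Rightarrow> nat \<times> nat \<Rightarrow> nat \<times> nat" where
  "run_step k A s = (if fst s = 0 then s
     else (fst s div k, table_lookup (fst (snd A)) (snd s) (fst s mod k)))"

text \<open>For \<open>k \<ge> 2\<close> a number \<open>n\<close> has at most \<open>n\<close>
  digits, and \<open>run_step\<close> is stationary after the last one, so \<open>n\<close> steps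
  run through the whole expansion.\<close>

definition table_member :: "nat \<Rightarrow> table \<Rightarrow> nat \<Rightarrow> bool" where
  "table_member k A n \<longleftrightarrow> snd ((run_step k A ^^ n) (n, fst A)) \<in> set (snd (snd A))"

text \<open>The code of the list of \<open>m\<close> entries \<open>n\<close>. It is the largest
  code of a list of length at most \<open>m\<close> with entries at most \<open>n\<close>, and thus
  limits the search for summands of \<open>n\<close>.\<close>

definition list_code_bound :: "nat \<Rightarrow> nat \<Rightarrow> nat" where
  "list_code_bound n m = rec_nat 0 (\<lambda>_ y. Suc (prod_encode (n, y))) m"

definition sum_member :: "nat \<Rightarrow> table \<Rightarrow> nat \<Rightarrow> nat \<Rightarrow> bool" where
  "sum_member k A N n \<longleftrightarrow> (\<exists>c<Suc (list_code_bound n N).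
     1 \<le> length (list_decode c) \<and> length (list_decode c) \<le> N \<and>
     sum_list (list_decode c) = n \<and> (\<forall>y\<in>set (list_decode c). table_member k A y))"

text \<open>A set given by an automaton with code \<open>a\<close> has at most \<open>2 a\<close> sections, and each section of the
  sumset is determined by a set of pairs of a list of at most \<open>N\<close> sections and a carry \<open>\<le> N\<close>.\<close>

definition section_bound :: "nat \<Rightarrow> nat \<Rightarrow> nat" where
  "section_bound a N = 2 ^ ((2 * a + 1) ^ N * (N + 1))"

text \<open>Any \<open>M\<close> beyond the tested range passes vacuously, so a least
  \<open>M\<close> always exists. Cofiniteness is decided by the single value
  \<open>M = k ^ section_bound (enc A) N\<close>.\<close>

definition basis_test :: "nat \<Rightarrow> table \<Rightarrow> nat \<Rightarrow> nat \<Rightarrow> bool" where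
  "basis_test k A N M \<longleftrightarrow> (\<forall>n<k ^ (2 * section_bound (enc A) N). M \<le> n \<longrightarrow> sum_member k A N n)"

text \<open>The constants \<open>E\<close>, \<open>K\<close>, \<open>C\<close> of the locale \<open>binary_blocks\<close> below are all at most
  \<open>k ^ (2 * a * a + 2 * a)\<close>.\<close>

definition summands_bound :: "nat \<Rightarrow> nat \<Rightarrow> nat" where
  "summands_bound k a = 2 * (k ^ (2 * a * a + 2 * a)) ^ 5 + k ^ (2 * a * a + 2 * a)"

text \<open>The first disjunct makes the search total; a result above the bound means that no
  \<open>N\<close> up to the bound works.\<close>

definition least_summands :: "nat \<Rightarrow> table \<Rightarrow> nat" where
  "least_summands k A = (LEAST N. summands_bound k (enc A) < N \<or>
     basis_test k A N (k ^ section_bound (enc A) N))"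

definition answer :: "nat \<Rightarrow> table \<Rightarrow> nat" where
  "answer k A = (if least_summands k A \<le> summands_bound k (enc A)
     then Suc (prod_encode (least_summands k A, LEAST M. basis_test k A (least_summands k A) M))
     else 0)"

lemma computable_table_member [computable]:
  assumes "computable k" "computable A" "computable n"
  shows "computable (\<lambda>x. table_member (k x) (A x) (n x))"
proof -
  have "computable (\<lambda>z. table_member (fst z) (fst (snd z)) (snd (snd z)))"
    unfolding table_member_def run_step_def table_lookup_def by (intro computable)
  from computable_comp[OF this, of "\<lambda>x. (k x, A x, n x)"] assms show ?thesis
    by (simp add: computable)
qed

lemma computable_sum_member [computable]:
  assumes "computable k" "computable A" "computable N" "computable n"
  shows "computable (\<lambda>x. sum_member (k x) (A x) (N x) (n x))"
proof -
  have "computable (\<lambda>z. sum_member (fst z) (fst (snd z)) (fst (snd (snd z))) (snd (snd (snd z))))"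
    unfolding sum_member_def list_code_bound_def by (intro computable)
  from computable_comp[OF this, of "\<lambda>x. (k x, A x, N x, n x)"] assms show ?thesis
    by (simp add: computable)
qed

lemma computable_section_bound [computable]:
  "computable a \<Longrightarrow> computable N \<Longrightarrow> computable (\<lambda>x. section_bound (a x) (N x))"
  unfolding section_bound_def by (intro computable)

lemma computable_summands_bound [computable]:
  "computable k \<Longrightarrow> computable a \<Longrightarrow> computable (\<lambda>x. summands_bound (k x) (a x))"
  unfolding summands_bound_def by (intro computable)

lemma computable_basis_test [computable]:
  assumes "computable k" "computable A" "computable N" "computable M"
  shows "computable (\<lambda>x. basis_test (k x) (A x) (N x) (M x))"
proof -
  have "computable (\<lambda>z. basis_test (fst z) (fst (snd z)) (fst (snd (snd z))) (snd (snd (snd z))))"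
    unfolding basis_test_def by (intro computable)
  from computable_comp[OF this, of "\<lambda>x. (k x, A x, N x, M x)"] assms show ?thesis
    by (simp add: computable)
qed

lemma computable_answer: "computable (\<lambda>z. answer (fst z) (snd z))"
proof -
  have *: "computable (\<lambda>z. least_summands (fst z) (snd z))"
    unfolding least_summands_def by (intro computable) (auto intro: exI lessI)
  have "computable (\<lambda>z. least_summands (fst (snd z)) (snd (snd z)))"
    using computable_comp[OF *, of "\<lambda>z. snd z"] by (simp add: computable)
  moreover have "\<exists>M. basis_test k A N M" for k A N
    unfolding basis_test_def by (meson leD)
  ultimately show ?thesis unfolding answer_def
    by (intro computable *)
qed

definition table_of :: "dfa \<Rightarrow> table" where
  "table_of A = (initial A, delta A, accepting A)"

lemma enc_table_of: "enc (table_of A) = dfa_code A"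
proof -
  have [simp]: "enc = (\<lambda>n::nat. n)" by (simp add: fun_eq_iff)
  have "enc = (\<lambda>xs::nat list. list_encode xs)" by (simp add: fun_eq_iff enc_list_def)
  then show ?thesis unfolding table_of_def dfa_code_def
    by (simp add: enc_list_def[where 'a = "nat list"])
qed

lemma answer_computes: "\<exists>p. \<forall>k A. computes p [k, dfa_code A] (answer k (table_of A))"
proof -
  obtain p where "\<And>z. computes p [enc z] (answer (fst z) (snd z))"
    using computable_answer unfolding computable_def recursive_def enc_nat_def by blast
  moreover have "enc (k, table_of A) = prod_encode (k, dfa_code A)" for k :: nat and A
    unfolding enc_prod[of "(k, table_of A)"] by (simp add: enc_table_of del: enc_prod)
  ultimately have p: "computes p [prod_encode (k, dfa_code A)] (answer k (table_of A))" for k A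
    by (metis fst_conv snd_conv)
  obtain q where "\<And>m n. computes q [m, n] (prod_encode (m, n))"
    using computes_prod_encode by blast
  with p have "computes (Comp p [q]) [k, dfa_code A] (answer k (table_of A))" for k A
    by (intro computes.Comp[where ys = "[prod_encode (k, dfa_code A)]"]) auto
  then show ?thesis by blast
qed

section \<open>Canonical expansions and automata\<close>

definition word_value :: "nat \<Rightarrow> nat list \<Rightarrow> nat" where
  "word_value k w = (\<Sum>i<length w. w ! i * k ^ i)"

lemma word_value_Nil [simp]: "word_value k [] = 0"
  by (simp add: word_value_def)

lemma word_value_Cons [simp]: "word_value k (a # w) = a + k * word_value k w"
  by (simp add: word_value_def sum.lessThan_Suc_shift sum_distrib_left algebra_simps
      del: sum.lessThan_Suc)

lemma word_value_append: "word_value k (u @ w) = word_value k u + k ^ length u * word_value k w"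
  by (induction u) (simp_all add: algebra_simps)

lemma word_value_less: "set w \<subseteq> {..<k} \<Longrightarrow> word_value k w < k ^ length w"
proof (induction w)
  case (Cons a w)
  then have "a + k * word_value k w < k + k * word_value k w" by simp
  also have "\<dots> = k * Suc (word_value k w)" by simp
  also have "\<dots> \<le> k * k ^ length w" using Cons by (intro mult_le_mono2) (simp add: Suc_le_eq)
  finally show ?case by simp
qed simp

lemma word_value_inj:
  "length v = length w \<Longrightarrow> set v \<subseteq> {..<k} \<Longrightarrow> set w \<subseteq> {..<k} \<Longrightarrow>
    word_value k v = word_value k w \<Longrightarrow> v = w"
proof (induction v w rule: list_induct2)
  case (Cons a v b w)
  then have "(a + k * word_value k v) mod k = (b + k * word_value k w) mod k" by simp
  moreover have "a < k" "b < k" using Cons.prems by auto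
  ultimately have "a = b" by (simp only: mod_mult_self2 mod_less)
  with Cons show ?case by auto
qed simp

lemma canonical_expansion_iff:
  "canonical_expansion k n w \<longleftrightarrow> set w \<subseteq> {..<k} \<and> (w \<noteq> [] \<longrightarrow> last w \<noteq> 0) \<and> word_value k w = n"
  by (simp add: canonical_expansion_def word_value_def)

function expansion :: "nat \<Rightarrow> nat \<Rightarrow> nat list" where
  "expansion k n = (if n = 0 \<or> k < 2 then [] else n mod k # expansion k (n div k))"
  by auto
termination by (relation "measure snd") auto

declare expansion.simps [simp del]

lemma expansion_0 [simp]: "expansion k 0 = []"
  by (simp add: expansion.simps)

lemma expansion_pos: "2 \<le> k \<Longrightarrow> 0 < n \<Longrightarrow> expansion k n = n mod k # expansion k (n div k)"
  by (subst expansion.simps) simp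

lemma word_value_expansion: "2 \<le> k \<Longrightarrow> word_value k (expansion k n) = n"
  by (induction k n rule: expansion.induct) (simp add: expansion.simps)

lemma canonical_expansion_expansion: "2 \<le> k \<Longrightarrow> canonical_expansion k n (expansion k n)"
proof (induction k n rule: expansion.induct)
  case (1 k n)
  show ?case
  proof (cases "n = 0")
    case False
    then have IH: "canonical_expansion k (n div k) (expansion k (n div k))" using 1 by simp
    have "last (expansion k n) \<noteq> 0"
    proof (cases "n div k = 0")
      case True
      then show ?thesis using False 1(2) by (simp add: expansion_pos div_eq_0_iff)
    next
      case nz: False
      then have "expansion k (n div k) \<noteq> []" using 1(2) by (simp add: expansion_pos)
      then show ?thesis using IH False 1(2) by (simp add: expansion_pos canonical_expansion_iff)
    qed
    then show ?thesis using IH False 1(2) by (simp add: expansion_pos canonical_expansion_iff)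
  qed (simp add: canonical_expansion_iff)
qed

lemma canonical_expansion_unique:
  "2 \<le> k \<Longrightarrow> canonical_expansion k n w \<longleftrightarrow> w = expansion k n"
proof
  show "2 \<le> k \<Longrightarrow> canonical_expansion k n w \<Longrightarrow> w = expansion k n"
  proof (induction w arbitrary: n)
    case Nil
    then show ?case by (simp add: canonical_expansion_iff)
  next
    case (Cons a w)
    then have n: "n = a + k * word_value k w" and a: "a < k"
      by (auto simp: canonical_expansion_iff)
    have w: "w = expansion k (word_value k w)"
      using Cons by (intro Cons.IH) (auto simp: canonical_expansion_iff split: if_splits)
    have "n > 0"
    proof (rule ccontr)
      assume "\<not> n > 0"
      then have "a = 0" "word_value k w = 0" using n Cons.prems(1) by auto
      then show False using w Cons.prems(2) by (auto simp: canonical_expansion_iff)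
    qed
    with n a w Cons.prems(1) show ?case by (simp add: expansion_pos)
  qed
qed (auto simp: canonical_expansion_expansion)

section \<open>Runs of the given automaton and correctness of the membership tests\<close>

abbreviation dfa_run :: "dfa \<Rightarrow> nat list \<Rightarrow> nat \<Rightarrow> nat" where
  "dfa_run A \<equiv> fold (\<lambda>a q. delta A ! q ! a)"

locale automatic_set =
  fixes k :: nat and A :: dfa and S :: "nat set"
  assumes k: "2 \<le> k" and automaton: "automaton_for k A S"
begin

abbreviation s :: nat where "s \<equiv> length (delta A)"

lemma dfa_over: "dfa_over k A"
  using automaton by (simp add: automaton_for_def)

lemma initial_less: "initial A < s"
  using dfa_over by (simp add: dfa_over_def)

lemma row_length: "q < s \<Longrightarrow> length (delta A ! q) = k"
  using dfa_over by (simp add: dfa_over_def)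

lemma delta_less: "q < s \<Longrightarrow> a < k \<Longrightarrow> delta A ! q ! a < s"
  using dfa_over unfolding dfa_over_def by (metis lessThan_iff nth_mem subsetD)

lemma dfa_run_less: "set w \<subseteq> {..<k} \<Longrightarrow> q < s \<Longrightarrow> dfa_run A w q < s"
  by (induction w arbitrary: q) (auto simp: delta_less)

lemma mem_iff_expansion: "n \<in> S \<longleftrightarrow> dfa_run A (expansion k n) (initial A) \<in> set (accepting A)"
proof -
  have L: "dfa_language k A = {w. \<exists>n\<in>S. canonical_expansion k n w}"
    using automaton by (simp add: automaton_for_def)
  have "n \<in> S \<longleftrightarrow> expansion k n \<in> dfa_language k A"
    unfolding L using canonical_expansion_expansion[OF k, of n] word_value_expansion[OF k]
    by (auto simp: canonical_expansion_unique[OF k]) metis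
  then show ?thesis
    using canonical_expansion_expansion[OF k, of n]
    by (simp add: dfa_language_def canonical_expansion_iff)
qed

text \<open>The language consists of canonical expansions only, so an accepted word needs no
  separate check of its leading digit.\<close>

lemma accepted_mem:
  assumes "set w \<subseteq> {..<k}" "dfa_run A w (initial A) \<in> set (accepting A)"
  shows "word_value k w \<in> S"
proof -
  have "w \<in> {w. \<exists>n\<in>S. canonical_expansion k n w}"
    using automaton assms by (auto simp: automaton_for_def dfa_language_def)
  then show ?thesis by (auto simp: canonical_expansion_iff)
qed

lemma run_step_funpow:
  "q < s \<Longrightarrow> n \<le> m \<Longrightarrow>
    snd ((run_step k (table_of A) ^^ m) (n, q)) = dfa_run A (expansion k n) q"
proof (induction m arbitrary: n q)
  case (Suc m)
  show ?case
  proof (cases "n = 0")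
    case True
    have "run_step k (table_of A) (0, q) = (0, q)" by (simp add: run_step_def)
    then show ?thesis using Suc True by (simp add: funpow_Suc_right del: funpow.simps(2))
  next
    case False
    have lt: "n mod k < k" using k by simp
    then have "run_step k (table_of A) (n, q) = (n div k, delta A ! q ! (n mod k))"
      using False Suc.prems by (simp add: run_step_def table_of_def table_lookup row_length)
    moreover have "n div k < n" using False k by simp
    then have "n div k \<le> m" using Suc.prems by linarith
    ultimately show ?thesis
      using Suc.IH[of "delta A ! q ! (n mod k)" "n div k"] delta_less[OF Suc.prems(1) lt] False k
      by (simp add: funpow_Suc_right expansion_pos del: funpow.simps(2))
  qed
qed simp

lemma table_member_iff: "table_member k (table_of A) n \<longleftrightarrow> n \<in> S"
proof -
  have "fst (table_of A) = initial A" "snd (snd (table_of A)) = accepting A"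
    by (simp_all add: table_of_def)
  then show ?thesis
    using run_step_funpow[OF initial_less order_refl, of n]
    by (simp add: table_member_def mem_iff_expansion)
qed

lemma list_encode_le_bound:
  "length xs \<le> m \<Longrightarrow> set xs \<subseteq> {..n} \<Longrightarrow> list_encode xs \<le> list_code_bound n m"
proof (induction m arbitrary: xs)
  case (Suc m)
  have "a \<le> n \<Longrightarrow> b \<le> c \<Longrightarrow> prod_encode (a, b) \<le> prod_encode (n, c)" for a b c
    unfolding prod_encode_def triangle_def
    by (auto intro!: add_mono div_le_mono mult_le_mono)
  then show ?case using Suc by (cases xs) (auto simp: list_code_bound_def)
qed (simp add: list_code_bound_def)

lemma sum_member_iff: "sum_member k (table_of A) N n \<longleftrightarrow> n \<in> sums_at_most N S"
proof
  assume "n \<in> sums_at_most N S"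
  then obtain xs where xs: "n = sum_list xs" "1 \<le> length xs" "length xs \<le> N" "set xs \<subseteq> S"
    by (auto simp: sums_at_most_def)
  have "set xs \<subseteq> {..n}" unfolding xs(1) by (auto intro: member_le_sum_list)
  then have "list_encode xs < Suc (list_code_bound n N)"
    using list_encode_le_bound xs(3) by (simp add: less_Suc_eq_le)
  then show "sum_member k (table_of A) N n"
    unfolding sum_member_def table_member_iff using xs
    by (intro exI[of _ "list_encode xs"]) auto
qed (auto simp: sum_member_def table_member_iff sums_at_most_def)

end

section \<open>Sections and pumping\<close>

text \<open>For \<open>j < k ^ i\<close> these sets form the \<open>k\<close>-kernel of
  \<open>T\<close>: what remains of \<open>T\<close> after the \<open>i\<close> lowest digits have
  been read, with value \<open>j\<close>.\<close>

definition section_set :: "nat \<Rightarrow> nat \<Rightarrow> nat \<Rightarrow> nat set \<Rightarrow> nat set" where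
  "section_set k i j T = {n. n * k ^ i + j \<in> T}"

text \<open>Pigeonhole over the \<open>b + 1\<close> depths \<open>0, ..., b\<close>, each with the
  residue of the one fixed number \<open>n\<close>.\<close>

lemma section_set_repeat:
  assumes "finite K" "card K \<le> b" "0 < k" "\<And>i j. j < k ^ i \<Longrightarrow> section_set k i j T \<in> K"
  obtains i i' where "i < i'" "i' \<le> b"
    "\<And>m. m * k ^ i + n mod k ^ i \<in> T \<longleftrightarrow> m * k ^ i' + n mod k ^ i' \<in> T"
proof -
  define f where "f i = section_set k i (n mod k ^ i) T" for i
  have "f ` {..b} \<subseteq> K" using assms(3,4) by (auto simp: f_def)
  then have "card (f ` {..b}) \<le> card K" using assms(1) by (rule card_mono[rotated])
  then have "card (f ` {..b}) < card {..b}" using assms(2) by simp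
  then have "\<not> inj_on f {..b}" by (rule pigeonhole)
  then obtain i i' where ii: "i \<le> b" "i' \<le> b" "i \<noteq> i'" "f i = f i'" by (auto simp: inj_on_def)
  then have eq: "\<And>m. m * k ^ i + n mod k ^ i \<in> T \<longleftrightarrow> m * k ^ i' + n mod k ^ i' \<in> T"
    by (auto simp: f_def section_set_def)
  show thesis
  proof (cases "i < i'")
    case True
    then show thesis using that ii eq by blast
  next
    case False
    then show thesis using that[of i' i] ii eq by simp
  qed
qed

text \<open>If depths \<open>i < i'\<close> give the same section, the low block of length
  \<open>i\<close> may be exchanged for the one of length \<open>i'\<close> below the same quotient.
  Upwards, the largest exception from \<open>k ^ b\<close> on would produce a larger one. Downwards,
  a number from \<open>k ^ (2 * b)\<close> on has a quotient by \<open>k ^ i'\<close> that is still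
  at least \<open>k ^ b\<close>, so the shortened number stays in the range of the
  induction.\<close>

lemma finite_sections_pumping:
  assumes K: "finite K" "card K \<le> b" and k: "2 \<le> k"
    and sections: "\<And>i j. j < k ^ i \<Longrightarrow> section_set k i j T \<in> K"
  shows pumping_up: "\<forall>n\<ge>M. n \<in> T \<Longrightarrow> k ^ b \<le> n \<Longrightarrow> n \<in> T"
    and pumping_down: "\<forall>n<k ^ (2 * b). k ^ b \<le> n \<longrightarrow> n \<in> T \<Longrightarrow> k ^ b \<le> n \<Longrightarrow> n \<in> T"
proof -
  have k0: "0 < k" using k by simp
  show "n \<in> T" if M: "\<forall>n\<ge>M. n \<in> T" and n: "k ^ b \<le> n"
  proof (rule ccontr)
    assume "n \<notin> T"
    define B where "B = {m. n \<le> m \<and> m \<notin> T}"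
    have "B \<subseteq> {..M}" using M by (auto simp: B_def intro: nat_le_linear) (meson nat_le_linear)
    then have "finite B" by (rule finite_subset) simp
    moreover have "n \<in> B" using \<open>n \<notin> T\<close> by (simp add: B_def)
    ultimately have max: "Max B \<in> B" "\<And>m. m \<in> B \<Longrightarrow> m \<le> Max B" using Max_in by auto
    define x where "x = Max B"
    have x: "n \<le> x" "x \<notin> T" using max(1) by (auto simp: B_def x_def)
    obtain i i' where ii: "i < i'" "i' \<le> b"
      "\<And>m. m * k ^ i + x mod k ^ i \<in> T \<longleftrightarrow> m * k ^ i' + x mod k ^ i' \<in> T"
      using section_set_repeat[OF K k0 sections] by metis
    define y where "y = x div k ^ i * k ^ i' + x mod k ^ i'"
    have "y \<notin> T" using ii(3)[of "x div k ^ i"] x(2) unfolding y_def div_mult_mod_eq by blast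
    have "k ^ i' \<le> x" using power_increasing[OF ii(2), of k] k n x(1) by linarith
    then have "0 < x div k ^ i'" using k0 by (simp add: div_greater_zero_iff)
    moreover have "x div k ^ i' = x div k ^ i div k ^ (i' - i)"
      using ii(1) by (simp flip: div_mult2_eq power_add)
    moreover have "1 < k ^ (i' - i)" using ii(1) k one_less_power[of k "i' - i"] by simp
    ultimately have "x div k ^ i' < x div k ^ i"
      by (metis div_less_dividend div_0 gr0I)
    then have "x div k ^ i' * k ^ i' < x div k ^ i * k ^ i'" using k0 by simp
    then have "x < y" unfolding y_def using div_mult_mod_eq[of x "k ^ i'"] by linarith
    then have "y \<in> B" using \<open>y \<notin> T\<close> x(1) by (simp add: B_def)
    then show False using max(2) \<open>x < y\<close> by (simp add: x_def leD)
  qed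
  show "n \<in> T" if T: "\<forall>n<k ^ (2 * b). k ^ b \<le> n \<longrightarrow> n \<in> T" and n: "k ^ b \<le> n"
    using n
  proof (induction n rule: less_induct)
    case (less x)
    show ?case
    proof (cases "x < k ^ (2 * b)")
      case False
      obtain i i' where ii: "i < i'" "i' \<le> b"
        "\<And>m. m * k ^ i + x mod k ^ i \<in> T \<longleftrightarrow> m * k ^ i' + x mod k ^ i' \<in> T"
        using section_set_repeat[OF K k0 sections] by metis
      define y where "y = x div k ^ i' * k ^ i + x mod k ^ i"
      have *: "x div k ^ i' = x div k ^ i div k ^ (i' - i)"
        using ii(1) by (simp flip: div_mult2_eq power_add)
      have "k ^ b * k ^ i' \<le> k ^ (2 * b)"
        using power_increasing[OF ii(2), of k] k by (simp add: mult_2 power_add)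
      also have "\<dots> \<le> x" using False by simp
      finally have b: "k ^ b \<le> x div k ^ i'" using k0 by (simp add: less_eq_div_iff_mult_less_eq)
      moreover have "0 < k ^ b" using k0 by simp
      moreover have "1 < k ^ (i' - i)" using ii(1) k one_less_power[of k "i' - i"] by simp
      ultimately have "x div k ^ i' < x div k ^ i"
        unfolding * by (metis div_less_dividend div_0 gr0I le_zero_eq less_irrefl)
      then have "x div k ^ i' * k ^ i < x div k ^ i * k ^ i" using k0 by simp
      then have "y < x" unfolding y_def using div_mult_mod_eq[of x "k ^ i"] by linarith
      moreover have "x div k ^ i' * 1 \<le> x div k ^ i' * k ^ i"
        using k0 by (intro mult_le_mono2) (simp add: Suc_le_eq)
      then have "k ^ b \<le> y" unfolding y_def using b by linarith
      ultimately have "y \<in> T" by (rule less.IH)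
      then show ?thesis using ii(3)[of "x div k ^ i'"] unfolding y_def div_mult_mod_eq by blast
    qed (use T less in auto)
  qed
qed

lemma sum_list_div_mod:
  "sum_list xs = sum_list (map (\<lambda>x. x div d) xs) * d + sum_list (map (\<lambda>x. x mod d) xs)" for d :: nat
  by (induction xs) (auto simp: algebra_simps)

lemma sum_list_less_length_mult:
  "set xs \<subseteq> {..<d} \<Longrightarrow> xs \<noteq> [] \<Longrightarrow> sum_list xs < length xs * (d::nat)"
proof (induction xs)
  case (Cons x xs)
  then show ?case by (cases xs) (auto intro: add_less_mono)
qed simp

lemma sum_powers_le: "(\<Sum>i\<le>N. c ^ i) \<le> Suc c ^ N"
proof (induction N)
  case (Suc N)
  have "c ^ N \<le> Suc c ^ N" by (intro power_mono) auto
  then have "c ^ Suc N \<le> c * Suc c ^ N" by (simp only: power_Suc mult_le_mono2)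
  with Suc have "(\<Sum>i\<le>N. c ^ i) + c ^ Suc N \<le> Suc c ^ N + c * Suc c ^ N" by (rule add_mono)
  then show ?case by simp
qed simp

text \<open>A section of a sumset is a union of translated sums of sections, the translation being the
  carry.\<close>

lemma sections_sums_at_most:
  assumes K: "finite K" and k: "0 < k"
    and sections: "\<And>i j. j < k ^ i \<Longrightarrow> section_set k i j S \<in> K"
  obtains K' where "finite K'" "card K' \<le> 2 ^ (Suc (card K) ^ N * (N + 1))"
    "\<And>i j. j < k ^ i \<Longrightarrow> section_set k i j (sums_at_most N S) \<in> K'"
proof
  define LS where "LS = {Us. set Us \<subseteq> K \<and> length Us \<le> N}"
  define G where "G F = {sum_list ys + c | ys Us c. (Us, c) \<in> F \<and> list_all2 (\<in>) ys Us}"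
    for F :: "(nat set list \<times> nat) set"
  define K' where "K' = G ` Pow (LS \<times> {..N})"
  have LS: "finite LS" "card LS \<le> Suc (card K) ^ N"
    unfolding LS_def using finite_lists_length_le[OF K, of N] card_lists_length_le[OF K, of N]
      sum_powers_le[of "card K" N] by auto
  show "finite K'" using LS(1) by (simp add: K'_def)
  have "card K' \<le> 2 ^ (card LS * (N + 1))"
    unfolding K'_def using card_image_le[of "Pow (LS \<times> {..N})" G] LS(1)
    by (simp add: card_Pow card_cartesian_product)
  also have "\<dots> \<le> 2 ^ (Suc (card K) ^ N * (N + 1))"
    using LS(2) by (intro power_increasing mult_le_mono1) auto
  finally show "card K' \<le> 2 ^ (Suc (card K) ^ N * (N + 1))" .
  fix i j assume j: "j < k ^ i"
  let ?d = "k ^ i"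
  have d: "0 < ?d" using k by simp
  \<comment> \<open>One pair for each choice of residues with sum \<open>j\<close> modulo
    \<open>?d\<close>. Only the list of sections and the carry are kept, and they range over
    \<open>LS \<times> {..N}\<close>, which depends on neither \<open>i\<close> nor
    \<open>j\<close>.\<close>
  define F where "F = {(map (\<lambda>r. section_set k i r S) rs, c) | rs c.
    set rs \<subseteq> {..<?d} \<and> 1 \<le> length rs \<and> length rs \<le> N \<and> sum_list rs = j + c * ?d}"
  have "F \<subseteq> LS \<times> {..N}"
  proof
    fix z assume "z \<in> F"
    then obtain rs c where z: "z = (map (\<lambda>r. section_set k i r S) rs, c)" "set rs \<subseteq> {..<?d}"
      "1 \<le> length rs" "length rs \<le> N" "sum_list rs = j + c * ?d" by (auto simp: F_def)
    have "c * ?d < length rs * ?d" using sum_list_less_length_mult[OF z(2)] z(3,5) by (cases rs) auto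
    then have "c \<le> N" using z(4) by simp
    then show "z \<in> LS \<times> {..N}" using z sections by (auto simp: LS_def)
  qed
  moreover have "section_set k i j (sums_at_most N S) = G F"
  proof (intro subset_antisym subsetI)
    fix n assume "n \<in> section_set k i j (sums_at_most N S)"
    then obtain xs where xs: "n * ?d + j = sum_list xs" "1 \<le> length xs" "length xs \<le> N" "set xs \<subseteq> S"
      by (auto simp: section_set_def sums_at_most_def)
    let ?rs = "map (\<lambda>x. x mod ?d) xs" and ?ys = "map (\<lambda>x. x div ?d) xs"
    define c where "c = sum_list ?rs div ?d"
    have eq: "n * ?d + j = sum_list ?ys * ?d + sum_list ?rs"
      using xs(1) sum_list_div_mod[of xs ?d] by simp
    then have "sum_list ?rs mod ?d = j"
      using j by (metis mod_less mod_mult_self3)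
    then have rs: "sum_list ?rs = j + c * ?d"
      unfolding c_def by (metis add.commute div_mult_mod_eq)
    then have "n * ?d = (sum_list ?ys + c) * ?d" using eq by (simp add: algebra_simps)
    then have n: "n = sum_list ?ys + c" using d by (metis mult_right_cancel less_not_refl)
    have "list_all2 (\<in>) ?ys (map (\<lambda>r. section_set k i r S) ?rs)"
      using xs(4) by (auto simp: list_all2_conv_all_nth section_set_def div_mult_mod_eq)
    moreover have "(map (\<lambda>r. section_set k i r S) ?rs, c) \<in> F"
      unfolding F_def using rs xs d by (auto intro!: exI[of _ ?rs])
    ultimately show "n \<in> G F" unfolding G_def n by blast
  next
    fix n assume "n \<in> G F"
    then obtain ys rs c where n: "n = sum_list ys + c" and rs: "1 \<le> length rs" "length rs \<le> N"
      "sum_list rs = j + c * ?d" and ys: "list_all2 (\<in>) ys (map (\<lambda>r. section_set k i r S) rs)"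
      by (auto simp: G_def F_def)
    define xs where "xs = map2 (\<lambda>y r. y * ?d + r) ys rs"
    have len: "length ys = length rs" using ys by (simp add: list_all2_conv_all_nth)
    have "sum_list xs = sum_list ys * ?d + sum_list rs"
      unfolding xs_def using len by (induction ys rs rule: list_induct2) (auto simp: algebra_simps)
    then have "sum_list xs = n * ?d + j" using rs n by (simp add: algebra_simps)
    moreover have "set xs \<subseteq> S"
      using ys by (auto simp: xs_def list_all2_conv_all_nth in_set_zip section_set_def)
    moreover have "length xs = length rs" using len by (simp add: xs_def)
    ultimately show "n \<in> section_set k i j (sums_at_most N S)"
      using rs unfolding section_set_def sums_at_most_def mem_Collect_eq by metis
  qed
  ultimately show "section_set k i j (sums_at_most N S) \<in> K'" by (auto simp: K'_def)
qed

section \<open>Sections of an automatic set and exactness of the basis test\<close>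

context automatic_set
begin

text \<open>The case \<open>n = 0\<close> is left out because the expansion of \<open>j\<close>
  alone may end before \<open>i\<close> digits have been read.\<close>

lemma state_after_low_digits:
  "j < k ^ i \<Longrightarrow> q < s \<Longrightarrow> \<exists>q'<s. \<forall>n>0.
    dfa_run A (expansion k (n * k ^ i + j)) q = dfa_run A (expansion k n) q'"
proof (induction i arbitrary: j q)
  case (Suc i)
  have k0: "0 < k" using k by simp
  let ?q = "delta A ! q ! (j mod k)"
  have "j div k < k ^ i" using Suc.prems(1) k0 by (simp add: less_mult_imp_div_less mult.commute)
  moreover have "?q < s" using Suc.prems(2) k0 by (simp add: delta_less)
  ultimately obtain q' where q': "q' < s"
    "\<And>n. n > 0 \<Longrightarrow> dfa_run A (expansion k (n * k ^ i + j div k)) ?q = dfa_run A (expansion k n) q'"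
    using Suc.IH by blast
  have "dfa_run A (expansion k (n * k ^ Suc i + j)) q = dfa_run A (expansion k n) q'" if "n > 0" for n
  proof -
    have "n * k ^ Suc i + j = j + (n * k ^ i) * k" by simp
    then have "(n * k ^ Suc i + j) div k = n * k ^ i + j div k"
      "(n * k ^ Suc i + j) mod k = j mod k" using k0 by (simp_all only: div_mult_self1 mod_mult_self1)
    moreover have "0 < n * k ^ Suc i + j" using that k0 by simp
    ultimately have "expansion k (n * k ^ Suc i + j) = j mod k # expansion k (n * k ^ i + j div k)"
      using expansion_pos[OF k, of "n * k ^ Suc i + j"] by (simp only:)
    then show ?thesis using q'(2)[OF that] by simp
  qed
  then show ?case using q'(1) by blast
qed auto

text \<open>A section is determined by the state reached and one bit for its element 0, where the
  expansion is cut short; hence the factor 2.\<close>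

lemma sections_finite:
  obtains K where "finite K" "card K \<le> 2 * s" "\<And>i j. j < k ^ i \<Longrightarrow> section_set k i j S \<in> K"
proof
  define U where "U = (\<lambda>(q, b). {n. if n = 0 then b else dfa_run A (expansion k n) q \<in> set (accepting A)})"
  define K where "K = U ` ({..<s} \<times> (UNIV :: bool set))"
  show "finite K" by (simp add: K_def)
  show "card K \<le> 2 * s"
    unfolding K_def using card_image_le[of "{..<s} \<times> (UNIV :: bool set)" U]
    by (simp add: card_cartesian_product mult.commute)
  fix i j assume "j < k ^ i"
  then obtain q where "q < s" "\<And>n. n > 0 \<Longrightarrow>
      dfa_run A (expansion k (n * k ^ i + j)) (initial A) = dfa_run A (expansion k n) q"
    using state_after_low_digits[OF _ initial_less] by blast
  then have "n \<in> section_set k i j S \<longleftrightarrow> n \<in> U (q, j \<in> S)" for n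
    unfolding U_def section_set_def by (cases "n = 0") (auto simp: mem_iff_expansion)
  then have "section_set k i j S = U (q, j \<in> S)" by blast
  then show "section_set k i j S \<in> K" using \<open>q < s\<close> by (auto simp: K_def)
qed

lemma states_le_code: "s \<le> enc (table_of A)"
proof -
  have "s \<le> enc (delta A)" by (rule length_le_enc)
  also have "\<dots> \<le> enc (delta A, accepting A)" by (simp add: le_prod_encode_1)
  also have "\<dots> \<le> enc (table_of A)" unfolding table_of_def by (simp add: le_prod_encode_2)
  finally show ?thesis .
qed

text \<open>Once the sumset is cofinite, it contains everything from
  \<open>k ^ section_bound\<close> on by pumping, so the tested range settles every \<open>M\<close>
  exactly.\<close>

lemma basis_from_iff_test:
  "basis_from S N M \<longleftrightarrow> basis_test k (table_of A) N M \<and> (\<exists>M'. basis_from S N M')"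
  "(\<exists>M'. basis_from S N M') \<longleftrightarrow> basis_test k (table_of A) N (k ^ section_bound (enc (table_of A)) N)"
proof -
  let ?a = "enc (table_of A)" and ?T = "sums_at_most N S"
  let ?b = "section_bound ?a N"
  obtain K where K: "finite K" "card K \<le> 2 * s" "\<And>i j. j < k ^ i \<Longrightarrow> section_set k i j S \<in> K"
    using sections_finite by blast
  have k0: "0 < k" using k by simp
  obtain K' where K': "finite K'" "card K' \<le> 2 ^ (Suc (card K) ^ N * (N + 1))"
    "\<And>i j. j < k ^ i \<Longrightarrow> section_set k i j ?T \<in> K'"
    using sections_sums_at_most[OF K(1) k0 K(3)] by blast
  note K'(2)
  also have "2 ^ (Suc (card K) ^ N * (N + 1)) \<le> ?b"
    unfolding section_bound_def using K(2) states_le_code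
    by (intro power_increasing mult_le_mono1 power_mono) auto
  finally have card: "card K' \<le> ?b" .
  note up = pumping_up[OF K'(1) card k K'(3)] and down = pumping_down[OF K'(1) card k K'(3)]
  have test: "basis_test k (table_of A) N M \<longleftrightarrow> (\<forall>n<k ^ (2 * ?b). M \<le> n \<longrightarrow> n \<in> ?T)" for M
    by (simp add: basis_test_def sum_member_iff)
  show ex: "(\<exists>M'. basis_from S N M') \<longleftrightarrow> basis_test k (table_of A) N (k ^ ?b)"
    unfolding test basis_from_def using up down by blast
  have "k ^ ?b \<le> k ^ (2 * ?b)" using k by (intro power_increasing) auto
  then have "n \<in> ?T" if "basis_test k (table_of A) N M" "basis_from S N M'" "M \<le> n" for n M'
    using that up[of M' n] unfolding test basis_from_def
    by (cases "n < k ^ (2 * ?b)") (auto)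
  then show "basis_from S N M \<longleftrightarrow> basis_test k (table_of A) N M \<and> (\<exists>M'. basis_from S N M')"
    unfolding basis_from_def test by blast
qed

end

section \<open>Sums of binary blocks\<close>

definition sums_of :: "nat \<Rightarrow> nat set \<Rightarrow> nat set" where
  "sums_of m S = {sum_list xs | xs. length xs = m \<and> set xs \<subseteq> S}"

lemma sums_of_0 [simp]: "sums_of 0 S = {0}"
  by (auto simp: sums_of_def)

lemma sums_of_add: "a \<in> sums_of m S \<Longrightarrow> b \<in> sums_of n S \<Longrightarrow> a + b \<in> sums_of (m + n) S"
  unfolding sums_of_def
proof clarify
  fix xs ys assume "set xs \<subseteq> S" "set ys \<subseteq> S"
  then show "\<exists>zs. sum_list xs + sum_list ys = sum_list zs \<and>
      length zs = length xs + length ys \<and> set zs \<subseteq> S"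
    by (intro exI[of _ "xs @ ys"]) auto
qed

lemma sums_of_mult: "a \<in> sums_of m S \<Longrightarrow> c * a \<in> sums_of (c * m) S"
  by (induction c) (auto intro: sums_of_add)

lemma sums_of_sum: "(\<And>t. t < r \<Longrightarrow> f t \<in> S) \<Longrightarrow> (\<Sum>t<r. f t) \<in> sums_of r S"
proof -
  assume "\<And>t. t < r \<Longrightarrow> f t \<in> S"
  moreover have "(\<Sum>t<r. f t) = sum_list (map f [0..<r])"
    by (simp add: interv_sum_list_conv_sum_set_nat atLeast0LessThan)
  ultimately show ?thesis
    unfolding sums_of_def by (auto intro!: exI[of _ "map f [0..<r]"])
qed

lemma sums_at_mostI: "n \<in> sums_of m S \<Longrightarrow> 1 \<le> m \<Longrightarrow> m \<le> N \<Longrightarrow> n \<in> sums_at_most N S"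
  by (auto simp: sums_of_def sums_at_most_def)

lemma sum_digits: "0 < K \<Longrightarrow> m < K ^ n \<Longrightarrow> (\<Sum>i<n. (m div K ^ i mod K) * K ^ i) = (m::nat)"
proof (induction n arbitrary: m)
  case (Suc n)
  have "m div K < K ^ n" using Suc.prems by (simp add: less_mult_imp_div_less mult.commute)
  then have "(\<Sum>i<n. (m div K div K ^ i mod K) * K ^ i) = m div K" using Suc by blast
  moreover have "(m div K ^ Suc i mod K) * K ^ Suc i = K * ((m div K div K ^ i mod K) * K ^ i)" for i
    by (simp add: div_mult2_eq)
  ultimately have "(\<Sum>i<n. (m div K ^ Suc i mod K) * K ^ Suc i) = K * (m div K)"
    by (simp only: flip: sum_distrib_left)
  then show ?case by (simp add: sum.lessThan_Suc_shift del: sum.lessThan_Suc)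
qed simp

text \<open>A block \<open>{A n + E * (\<Sum>i<n. e i * K ^ i) | e i \<in> {0, 1}}\<close> becomes, after \<open>K - 1\<close>-fold
  addition, a full arithmetic progression, as every digit is a sum of \<open>K - 1\<close> bits. Mixing
  summands from consecutive blocks makes the progressions overlap; the number of summands is
  a multiple of \<open>E\<close>, so that the progressions all lie in the class of \<open>0\<close> modulo \<open>E\<close>.\<close>

locale binary_blocks =
  fixes S :: "nat set" and A :: "nat \<Rightarrow> nat" and E K C :: nat
  assumes K: "2 \<le> K" and E: "1 \<le> E"
    and blocks: "\<And>n e. (\<And>i. e i \<le> 1) \<Longrightarrow> A n + E * (\<Sum>i<n. e i * K ^ i) \<in> S"
    and A_bound: "\<And>n. A n \<le> C * K ^ n"
begin

lemma progression:
  assumes "m < K ^ n" shows "(K - 1) * A n + E * m \<in> sums_of (K - 1) S"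
proof -
  define d where "d i = m div K ^ i mod K" for i
  define e where "e t i = (if t < d i then 1 else 0 :: nat)" for t i
  have "(\<Sum>t<K - 1. A n + E * (\<Sum>i<n. e t i * K ^ i)) \<in> sums_of (K - 1) S"
    by (intro sums_of_sum blocks) (simp add: e_def)
  also have "(\<Sum>t<K - 1. A n + E * (\<Sum>i<n. e t i * K ^ i)) =
      (K - 1) * A n + E * (\<Sum>t<K - 1. \<Sum>i<n. e t i * K ^ i)"
    by (simp add: sum.distrib sum_distrib_left)
  also have "(\<Sum>t<K - 1. \<Sum>i<n. e t i * K ^ i) = (\<Sum>i<n. (\<Sum>t<K - 1. e t i) * K ^ i)"
    by (subst sum.swap) (simp add: sum_distrib_right)
  also have "\<dots> = (\<Sum>i<n. d i * K ^ i)"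
  proof (intro sum.cong refl arg_cong2[of _ _ _ _ "(*)"])
    fix i
    have "d i < K" using K by (simp add: d_def)
    then have "{..<K - 1} \<inter> {t. t < d i} = {..<d i}" by auto
    then show "(\<Sum>t<K - 1. e t i) = d i"
      unfolding e_def by (simp add: sum.If_cases)
  qed
  also have "\<dots> = m" unfolding d_def using K assms by (intro sum_digits) auto
  finally show ?thesis .
qed

definition P :: "nat \<Rightarrow> nat" where "P n = (K - 1) * A n"

definition H :: nat where "H = E * (K - 1)"

text \<open>Adding \<open>E - 1\<close> further copies of the first term turns the offset
  \<open>P n\<close> into \<open>E * P n\<close>, so that a factor \<open>E\<close> can be
  extracted.\<close>

lemma progression_multiple:
  assumes "m < K ^ n" shows "E * (P n + m) \<in> sums_of H S"
proof -
  have "(K - 1) * A n + E * 0 \<in> sums_of (K - 1) S" using K by (intro progression) simp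
  then have "(E - 1) * P n \<in> sums_of ((E - 1) * (K - 1)) S"
    by (intro sums_of_mult) (simp add: P_def)
  with progression[OF assms]
  have "P n + E * m + (E - 1) * P n \<in> sums_of ((K - 1) + (E - 1) * (K - 1)) S"
    unfolding P_def by (rule sums_of_add)
  moreover obtain E' where "E = Suc E'" using E by (cases E) auto
  then have "P n + E * m + (E - 1) * P n = E * (P n + m)" "(K - 1) + (E - 1) * (K - 1) = H"
    unfolding H_def by (simp_all add: distrib_left)
  ultimately show ?thesis by simp
qed

lemma block_sums:
  "y \<le> r * (K ^ n - 1) \<Longrightarrow> E * (r * P n + y) \<in> sums_of (r * H) S"
proof (induction r arbitrary: y)
  case (Suc r)
  define z where "z = min y (K ^ n - 1)"
  have "y - z \<le> r * (K ^ n - 1)" using Suc.prems by (auto simp: z_def)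
  then have "E * (r * P n + (y - z)) \<in> sums_of (r * H) S" by (rule Suc.IH)
  moreover have "0 < K ^ n" using K by simp
  then have "z < K ^ n" unfolding z_def by linarith
  then have "E * (P n + z) \<in> sums_of H S" by (rule progression_multiple)
  ultimately have "E * (P n + z) + E * (r * P n + (y - z)) \<in> sums_of (H + r * H) S"
    by (rule sums_of_add[rotated])
  moreover have "E * (P n + z) + E * (r * P n + (y - z)) = E * (Suc r * P n + y)"
    by (simp add: z_def flip: distrib_left)
  ultimately show ?case by simp
qed simp

text \<open>Chosen so that \<open>P (Suc n) \<le> J * (K ^ n - 1)\<close> for
  \<open>n \<ge> 1\<close>: \<open>P (Suc n)\<close> is at most
  \<open>(K - 1) * C * K * K ^ n\<close>, and the factor 2 absorbs the passage from
  \<open>K ^ n\<close> to \<open>K ^ n - 1\<close>.\<close>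

definition J :: nat where "J = 2 * ((K - 1) * C) * K"

lemma mixed_block_sums:
  assumes "j \<le> J" "y \<le> J * (K ^ n - 1)"
  shows "E * ((J - j) * P n + j * P (Suc n) + y) \<in> sums_of (J * H) S"
proof -
  define z where "z = min y ((J - j) * (K ^ n - 1))"
  have "J * (K ^ n - 1) = (J - j) * (K ^ n - 1) + j * (K ^ n - 1)"
    using assms(1) by (simp flip: distrib_right)
  then have "y - z \<le> j * (K ^ n - 1)" using assms(2) unfolding z_def by linarith
  also have "\<dots> \<le> j * (K ^ Suc n - 1)"
    using K by (intro mult_le_mono2 diff_le_mono power_increasing) auto
  finally have "E * (j * P (Suc n) + (y - z)) \<in> sums_of (j * H) S" by (rule block_sums)
  moreover have "E * ((J - j) * P n + z) \<in> sums_of ((J - j) * H) S"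
    by (rule block_sums) (simp add: z_def)
  ultimately have "E * ((J - j) * P n + z) + E * (j * P (Suc n) + (y - z)) \<in> sums_of ((J - j) * H + j * H) S"
    by (rule sums_of_add[rotated])
  moreover have "(J - j) * H + j * H = J * H" using assms by (simp flip: distrib_right)
  moreover have "E * ((J - j) * P n + z) + E * (j * P (Suc n) + (y - z)) =
      E * ((J - j) * P n + j * P (Suc n) + y)"
    by (simp add: z_def flip: distrib_left)
  ultimately show ?thesis by simp
qed

lemma P_step: "1 \<le> n \<Longrightarrow> P (Suc n) \<le> J * (K ^ n - 1) + 1"
proof -
  assume "1 \<le> n"
  then have "2 \<le> K ^ n" using K power_increasing[of 1 n K] by simp
  then have "K ^ n \<le> 2 * (K ^ n - 1)" by simp
  moreover have "P (Suc n) \<le> (K - 1) * (C * K ^ Suc n)"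
    unfolding P_def by (intro mult_le_mono2 A_bound)
  moreover have "(K - 1) * (C * K ^ Suc n) = (K - 1) * C * K * K ^ n" by simp
  ultimately have "P (Suc n) \<le> (K - 1) * C * K * (2 * (K ^ n - 1))"
    by (metis mult_le_mono2 order_trans)
  also have "\<dots> = J * (K ^ n - 1)" by (simp add: J_def)
  finally show ?thesis by simp
qed

text \<open>Up to the factor \<open>E\<close>: exchanging one of the \<open>J\<close> groups of
  \<open>H\<close> summands from block \<open>n\<close> for one from block \<open>Suc n\<close>
  raises the first term by at most \<open>P (Suc n)\<close>. By \<open>P_step\<close> this exceeds
  the span \<open>J * (K ^ n - 1)\<close> of a progression by at most one, so no gap arises.\<close>

lemma between_blocks:
  assumes n: "1 \<le> n" and x: "J * P n \<le> x" "x \<le> J * P (Suc n) + J * (K ^ n - 1)"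
  shows "E * x \<in> sums_of (J * H) S"
proof -
  let ?start = "\<lambda>j. (J - j) * P n + j * P (Suc n)"
  define j where "j = (GREATEST j. j \<le> J \<and> ?start j \<le> x)"
  have "0 \<le> J \<and> ?start 0 \<le> x" using x by simp
  then have j: "j \<le> J \<and> ?start j \<le> x"
    unfolding j_def by (rule GreatestI_nat[where b = J]) auto
  have "x \<le> ?start j + J * (K ^ n - 1)"
  proof (cases "j = J")
    case True
    then show ?thesis using x by simp
  next
    case False
    have "\<not> (Suc j \<le> J \<and> ?start (Suc j) \<le> x)"
      using Greatest_le_nat[of "\<lambda>j. j \<le> J \<and> ?start j \<le> x" "Suc j" J] unfolding j_def by fastforce
    then have "x < ?start (Suc j)" using j False by simp
    moreover have "?start (Suc j) \<le> ?start j + P (Suc n)" by (simp add: algebra_simps mult_le_mono1)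
    ultimately show ?thesis using P_step[OF n] by linarith
  qed
  then have "x - ?start j \<le> J * (K ^ n - 1)" by linarith
  from mixed_block_sums[of j, OF _ this] j show ?thesis by simp
qed

lemma multiples:
  assumes "1 \<le> C" "J * P 1 \<le> x"
  shows "E * x \<in> sums_of (J * H) S"
proof -
  have J: "1 \<le> J" using K assms(1) by (simp add: J_def)
  let ?end = "\<lambda>m. J * P m + J * (K ^ m - 1)"
  \<comment> \<open>The least block whose progression reaches \<open>x\<close>. If \<open>x\<close>
    lies before its start, it lies between block \<open>m - 1\<close> and block \<open>m\<close>.
    Index 0 is excluded because \<open>P_step\<close> needs \<open>1 \<le> n\<close>.\<close>
  define m where "m = (LEAST m. 1 \<le> m \<and> x \<le> ?end m)"
  have "x < 2 ^ x" by simp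
  also have "(2::nat) ^ x \<le> K ^ x" using K by (rule power_mono) simp
  also have "\<dots> \<le> K ^ Suc x" using K by simp
  finally have "x \<le> K ^ Suc x - 1" by simp
  also have "\<dots> \<le> ?end (Suc x)" using J by (simp add: trans_le_add2)
  finally have "1 \<le> Suc x \<and> x \<le> ?end (Suc x)" by simp
  then have m: "1 \<le> m \<and> x \<le> ?end m" unfolding m_def by (rule LeastI)
  show ?thesis
  proof (cases "J * P m \<le> x")
    case True
    have "x - J * P m \<le> J * (K ^ m - 1)" using m by linarith
    from block_sums[OF this] True show ?thesis by simp
  next
    case False
    then obtain n where n: "m = Suc n" "1 \<le> n" using m assms(2) by (cases m; cases "m = 1") auto
    have "\<not> (1 \<le> n \<and> x \<le> ?end n)"
      using not_less_Least[of n "\<lambda>m. 1 \<le> m \<and> x \<le> ?end m"] n unfolding m_def by simp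
    then show ?thesis using n False by (intro between_blocks[of n]) auto
  qed
qed

end

section \<open>Residues and counting\<close>

text \<open>The factor between two visits to the same point can be cut out. The general
  \<open>fold\<close> form serves sums modulo \<open>E\<close>, runs of the automaton and pairs of
  parallel runs alike.\<close>

lemma run_shorten:
  assumes "finite X" "\<And>a x. a \<in> L \<Longrightarrow> x \<in> X \<Longrightarrow> f a x \<in> X" "set w \<subseteq> L" "x \<in> X"
  obtains w' where "set w' \<subseteq> L" "length w' < card X" "fold f w' x = fold f w x"
proof -
  have run: "fold f v x \<in> X" if "set v \<subseteq> L" for v
    using that assms(4) by (induction v arbitrary: x) (auto simp: assms(2))
  have "\<exists>w'. set w' \<subseteq> L \<and> length w' < card X \<and> fold f w' x = fold f w x"
    using assms(3)
  proof (induction "length w" arbitrary: w rule: less_induct)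
    case less
    show ?case
    proof (cases "length w < card X")
      case False
      define g where "g i = fold f (take i w) x" for i
      have "g ` {..length w} \<subseteq> X"
        unfolding g_def using less.prems by (auto intro!: run dest: in_set_takeD)
      then have "card (g ` {..length w}) \<le> card X" using assms(1) by (rule card_mono[rotated])
      then have "card (g ` {..length w}) < card {..length w}" using False by simp
      then have "\<not> inj_on g {..length w}" by (rule pigeonhole)
      then obtain i j where "i \<le> length w" "j \<le> length w" "i \<noteq> j" "g i = g j"
        by (auto simp: inj_on_def)
      then obtain i j where ij: "i < j" "j \<le> length w" "g i = g j"
        by (metis linorder_neqE_nat)
      define v where "v = take i w @ drop j w"
      have "fold f v x = fold f (take j w @ drop j w) x"
        using ij(3) by (simp add: v_def g_def del: append_take_drop_id)
      then have "fold f v x = fold f w x" unfolding append_take_drop_id .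
      moreover have "length v < length w" "set v \<subseteq> L"
        using ij less.prems by (auto simp: v_def dest: in_set_takeD in_set_dropD)
      ultimately show ?thesis using less.hyps by metis
    qed (use less in blast)
  qed
  then show thesis using that by blast
qed

text \<open>The numbers whose residues are reached by sums form a subgroup modulo \<open>E\<close>,
  so their least positive member \<open>d\<close> divides all of \<open>S\<close> and must be 1.
  Cutting repeated partial sums modulo \<open>E\<close> makes the list short.\<close>

lemma Gcd_eq_1_residues:
  fixes S :: "nat set"
  assumes "Gcd S = 1" "1 \<le> E"
  obtains w where "set w \<subseteq> S" "length w < E" "sum_list w mod E = r mod E"
proof -
  define G where "G = {x. \<exists>w. set w \<subseteq> S \<and> sum_list w mod E = x mod E}"
  have G_add: "x + y \<in> G" if "x \<in> G" "y \<in> G" for x y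
  proof -
    from that obtain v w where "set v \<subseteq> S" "sum_list v mod E = x mod E" "set w \<subseteq> S" "sum_list w mod E = y mod E"
      by (auto simp: G_def)
    then have "set (v @ w) \<subseteq> S" "sum_list (v @ w) mod E = (x + y) mod E"
      by (auto intro: mod_add_cong)
    then show ?thesis unfolding G_def by blast
  qed
  have "0 \<in> G" by (auto simp: G_def intro!: exI[of _ "[]"])
  then have G_mult: "c * x \<in> G" if "x \<in> G" for c x
    using that by (induction c) (auto intro: G_add)
  have G_mod: "x \<in> G \<longleftrightarrow> y \<in> G" if "x mod E = y mod E" for x y
    using that by (simp add: G_def)
  have G_S: "x \<in> G" if "x \<in> S" for x
    using that by (auto simp: G_def intro!: exI[of _ "[x]"])
  have "E \<in> G" using G_mod[of E 0] \<open>0 \<in> G\<close> by simp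
  define d where "d = (LEAST d. 0 < d \<and> d \<in> G)"
  have d: "0 < d \<and> d \<in> G"
    unfolding d_def by (rule LeastI[of _ E]) (use \<open>E \<in> G\<close> assms in auto)
  have "d dvd x" if "x \<in> S" for x
  proof (rule ccontr)
    assume "\<not> d dvd x"
    then have pos: "0 < x mod d" by (simp add: dvd_eq_mod_eq_0)
    define t m where "t = x div d" and "m = x mod d"
    have x: "x = m + t * d" by (simp add: t_def m_def)
    obtain E' where E': "E = Suc E'" using assms(2) by (cases E) auto
    \<comment> \<open>Adding \<open>d\<close> another \<open>t * (E - 1)\<close> times replaces
      subtracting it \<open>t\<close> times modulo \<open>E\<close>.\<close>
    have "x + (t * E') * d \<in> G" using G_add[OF G_S[OF that] G_mult[OF conjunct2[OF d]]] .
    moreover have "x + (t * E') * d = m + (t * d) * E" unfolding x E' by (simp add: algebra_simps)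
    ultimately have "m \<in> G" using G_mod[of m "m + (t * d) * E"] by (simp only: mod_mult_self1)
    then have "x mod d \<in> G" by (simp only: m_def)
    with pos have "d \<le> x mod d" unfolding d_def by (intro Least_le) simp
    moreover have "x mod d < d" using d by simp
    ultimately show False by simp
  qed
  then have "d dvd Gcd S" by (rule Gcd_greatest)
  then have "1 \<in> G" using assms(1) d by simp
  then have "r \<in> G" using G_mult[of 1 r] by simp
  then obtain v where v: "set v \<subseteq> S" "sum_list v mod E = r mod E" by (auto simp: G_def)
  define f where "f a q = (q + a) mod E" for a q :: nat
  have fold_f: "fold f w q mod E = (q + sum_list w) mod E" for w q
    by (induction w arbitrary: q) (auto simp: f_def mod_simps add.assoc)
  obtain w where w: "set w \<subseteq> S" "length w < card {..<E}" "fold f w 0 = fold f v 0"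
    using run_shorten[of "{..<E}" S f v 0] assms(2) v(1) by (auto simp: f_def)
  then have "sum_list w mod E = r mod E" using fold_f[of w 0] fold_f[of v 0] v(2) by simp
  then show thesis using that w by simp
qed

lemma basis_from_multiples:
  assumes "Gcd S = 1" "1 \<le> E" "1 \<le> H" "\<And>x. X \<le> x \<Longrightarrow> E * x \<in> sums_of H S"
  shows "\<exists>M. basis_from S (H + E) M"
proof -
  have "\<exists>w. set w \<subseteq> S \<and> length w < E \<and> sum_list w mod E = r mod E" for r
    using Gcd_eq_1_residues[OF assms(1,2)] by metis
  then obtain w where w: "\<And>r. set (w r) \<subseteq> S" "\<And>r. length (w r) < E"
    "\<And>r. sum_list (w r) mod E = r mod E" by metis
  define M where "M = E * X + (\<Sum>r<E. sum_list (w r))"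
  have "n \<in> sums_at_most (H + E) S" if n: "M \<le> n" for n
  proof -
    define r where "r = n mod E"
    have "r < E" using assms(2) by (simp add: r_def)
    then have "sum_list (w r) \<le> (\<Sum>r<E. sum_list (w r))" by (intro member_le_sum) auto
    then have le: "E * X + sum_list (w r) \<le> n" using n by (simp add: M_def)
    have "sum_list (w r) mod E = n mod E" using w(3)[of r] by (simp add: r_def)
    then have "E dvd n - sum_list (w r)" using le mod_eq_dvd_iff_nat[of "sum_list (w r)" n E] by (metis add_leD2)
    then obtain x where x: "n - sum_list (w r) = E * x" by blast
    then have "E * X \<le> E * x" using le by linarith
    then have "X \<le> x" using assms(2) by simp
    then have "E * x \<in> sums_of H S" by (rule assms(4))
    moreover have "sum_list (w r) \<in> sums_of (length (w r)) S" using w(1) by (auto simp: sums_of_def)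
    ultimately have "E * x + sum_list (w r) \<in> sums_of (H + length (w r)) S" by (rule sums_of_add)
    moreover have "E * x + sum_list (w r) = n" using x le by linarith
    ultimately show ?thesis using w(2)[of r] assms(3)
      by (intro sums_at_mostI[of n "H + length (w r)"]) auto
  qed
  then show ?thesis unfolding basis_from_def by blast
qed

lemma basis_from_Gcd:
  assumes "basis_from S N M" shows "Gcd S = 1"
proof -
  have "Gcd S dvd n" if "M \<le> n" for n
  proof -
    have "n \<in> sums_at_most N S" using assms that by (simp add: basis_from_def)
    then obtain xs where "n = sum_list xs" "set xs \<subseteq> S" by (auto simp: sums_at_most_def)
    moreover have "set xs \<subseteq> S \<Longrightarrow> Gcd S dvd sum_list xs" for xs
      by (induction xs) auto
    ultimately show ?thesis by simp
  qed
  from this[of M] this[of "Suc M"] have "Gcd S dvd Suc M - M" by (intro dvd_diff_nat) auto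
  then show ?thesis by simp
qed

section \<open>Sparse sets are not bases\<close>

lemma ln_power_smallo: "(\<lambda>x::real. ln x ^ m) \<in> o[at_top](\<lambda>x. x)"
proof (rule smalloI_tendsto)
  have "((\<lambda>x::real. x ^ m / exp x) \<longlongrightarrow> 0) at_top" by (rule tendsto_power_div_exp_0)
  then have "((\<lambda>x::real. ln x ^ m / exp (ln x)) \<longlongrightarrow> 0) at_top"
    using ln_at_top by (rule filterlim_compose)
  then show "((\<lambda>x::real. ln x ^ m / x) \<longlongrightarrow> 0) at_top"
    by (rule Lim_transform_eventually) (auto intro: eventually_mono[OF eventually_gt_at_top[of 0]])
  show "\<forall>\<^sub>F x::real in at_top. x \<noteq> 0" by (auto intro: eventually_mono[OF eventually_gt_at_top[of 0]])
qed

lemma counting_real_nat: "counting S (real n) = card (S \<inter> {..n})"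
  unfolding counting_def by (rule arg_cong[of _ _ card]) auto

text \<open>Every number in \<open>{M..<n}\<close> is the sum of a list of at most \<open>N\<close>
  elements of \<open>S \<inter> {..n}\<close>. There are at most \<open>(c + 1) ^ N\<close> such
  lists, where \<open>c\<close> is the size of that set; for sparse \<open>S\<close> this is a power
  of a logarithm and falls below \<open>n / 2\<close>.\<close>

lemma basis_from_not_sparse:
  assumes "basis_from S N M" shows "\<not> sparse S"
proof
  assume "sparse S"
  then obtain d where d: "(\<lambda>x. real (counting S x)) \<in> O[at_top](\<lambda>x. ln x ^ d)"
    by (auto simp: sparse_def)
  have "1 \<le> ln x ^ d" if "exp 1 \<le> x" for x :: real
    using that by (intro one_le_power) (simp add: ln_ge_iff order_less_le_trans[OF exp_gt_zero])
  then have "(\<lambda>_. 1 :: real) \<in> O[at_top](\<lambda>x. ln x ^ d)"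
    by (intro bigoI[of _ 1] eventually_mono[OF eventually_ge_at_top[of "exp 1"]])
      (auto intro: order_trans[OF _ abs_ge_self])
  with d have "(\<lambda>x. real (counting S x) + 1) \<in> O[at_top](\<lambda>x. ln x ^ d)" by (rule sum_in_bigo)
  then have "(\<lambda>x. (real (counting S x) + 1) ^ N) \<in> O[at_top](\<lambda>x. (ln x ^ d) ^ N)"
    by (rule landau_o.big_power)
  also have "(\<lambda>x::real. (ln x ^ d) ^ N) \<in> o[at_top](\<lambda>x. x)"
    using ln_power_smallo by (simp flip: power_mult)
  finally have "\<forall>\<^sub>F x in at_top. norm ((real (counting S x) + 1) ^ N) \<le> (1 / 2) * norm x"
    by (rule landau_o.smallD) simp
  then obtain x0 where x0: "\<And>x. x \<ge> x0 \<Longrightarrow> norm ((real (counting S x) + 1) ^ N) \<le> (1 / 2) * norm x"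
    by (auto simp: eventually_at_top_linorder)
  \<comment> \<open>Large enough for the growth estimate, and greater than \<open>2 * M\<close>, so
    that \<open>n - M\<close> exceeds \<open>n / 2\<close>.\<close>
  define n where "n = nat \<lceil>x0\<rceil> + 2 * M + 1"
  have "x0 \<le> real n" unfolding n_def by linarith
  then have upper: "real ((card (S \<inter> {..n}) + 1) ^ N) \<le> real n / 2"
    using x0[of "real n"] by (simp add: counting_real_nat add.commute)
  define LS where "LS = {xs. set xs \<subseteq> S \<inter> {..n} \<and> length xs \<le> N}"
  have LS: "finite LS" "card LS \<le> Suc (card (S \<inter> {..n})) ^ N"
    unfolding LS_def using finite_lists_length_le[of "S \<inter> {..n}" N]
      card_lists_length_le[of "S \<inter> {..n}" N] sum_powers_le[of "card (S \<inter> {..n})" N] by auto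
  have "{M..<n} \<subseteq> sum_list ` LS"
  proof
    fix m assume "m \<in> {M..<n}"
    then obtain xs where xs: "m = sum_list xs" "length xs \<le> N" "set xs \<subseteq> S" "m < n"
      using assms by (auto simp: basis_from_def sums_at_most_def)
    have "x \<le> n" if "x \<in> set xs" for x
      using member_le_sum_list[OF that] xs(1,4) by simp
    then have "xs \<in> LS" using xs(2,3) by (auto simp: LS_def)
    then show "m \<in> sum_list ` LS" using xs(1) by (rule image_eqI[rotated])
  qed
  then have "card {M..<n} \<le> card (sum_list ` LS)" using LS(1) by (intro card_mono) auto
  also have "\<dots> \<le> card LS" using LS(1) by (rule card_image_le)
  finally have "n - M \<le> (card (S \<inter> {..n}) + 1) ^ N" using LS(2) by simp
  then have "real (n - M) \<le> real ((card (S \<inter> {..n}) + 1) ^ N)" by (simp only: of_nat_le_iff)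
  with upper have "real (n - M) \<le> real n / 2" by linarith
  then show False unfolding n_def by simp
qed

section \<open>Double loops\<close>

lemma nth_mismatch:
  assumes "length v = length w" "v \<noteq> w"
  obtains i where "i < length w" "v ! i \<noteq> w ! i" "take i v = take i w"
proof -
  define i where "i = (LEAST i. i < length w \<and> v ! i \<noteq> w ! i)"
  have "\<exists>i. i < length w \<and> v ! i \<noteq> w ! i" using assms nth_equalityI by metis
  then have i: "i < length w \<and> v ! i \<noteq> w ! i" unfolding i_def by (rule LeastI_ex)
  have "v ! j = w ! j" if "j < i" for j
    using not_less_Least[of j "\<lambda>i. i < length w \<and> v ! i \<noteq> w ! i"] that i unfolding i_def by auto
  then have "take i v = take i w" using i assms(1) by (intro nth_take_lemma) auto
  then show thesis using that i by blast
qed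

lemma length_expansion_le: "2 \<le> k \<Longrightarrow> n < 2 ^ l \<Longrightarrow> length (expansion k n) \<le> l"
proof (induction l arbitrary: n)
  case (Suc l)
  show ?case
  proof (cases "n = 0")
    case False
    have "n div k \<le> n div 2" using Suc.prems by (intro div_le_mono2) auto
    also have "\<dots> < 2 ^ l" using Suc.prems by auto
    finally show ?thesis using Suc False by (simp add: expansion_pos)
  qed simp
qed simp

context automatic_set
begin

text \<open>The loops have equal length so that choosing one or the other in a sequence of loops
  does not move the digits that follow.\<close>

definition double_loop :: "nat list \<Rightarrow> nat list \<Rightarrow> nat list \<Rightarrow> nat list \<Rightarrow> bool" where
  "double_loop u y z v \<longleftrightarrow>
     set u \<subseteq> {..<k} \<and> set y \<subseteq> {..<k} \<and> set z \<subseteq> {..<k} \<and> set v \<subseteq> {..<k} \<and>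
     length y = length z \<and> y \<noteq> z \<and>
     dfa_run A y (dfa_run A u (initial A)) = dfa_run A u (initial A) \<and>
     dfa_run A z (dfa_run A u (initial A)) = dfa_run A u (initial A) \<and>
     dfa_run A v (dfa_run A u (initial A)) \<in> set (accepting A)"

definition accepted_words :: "nat \<Rightarrow> nat list set" where
  "accepted_words n = {w. set w \<subseteq> {..<k} \<and> length w = n \<and> dfa_run A w (initial A) \<in> set (accepting A)}"

text \<open>An accepted word is determined by the position of the last visit to each state and the letter
  read there: two words that first differ after reaching a state \<open>q\<close> must, if their data agree,
  both return to \<open>q\<close> at a common later position.\<close>

lemma card_accepted_words:
  assumes "\<nexists>u y z v. double_loop u y z v"
  shows "card (accepted_words n) \<le> (Suc n * k) ^ s"
proof -
  define st where "st w i = dfa_run A (take i w) (initial A)" for w i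
  define visits where "visits w q = {i. i < n \<and> st w i = q}" for w q
  \<comment> \<open>The inserted 0 is the value for states that are never visited; it cannot change
    the maximum of a nonempty set of visits.\<close>
  define last_visit where "last_visit w q = Max (insert 0 (visits w q))" for w q
  define letter where "letter w i = (if i < n then w ! i else 0)" for w :: "nat list" and i
  define sig where "sig w = (\<lambda>q\<in>{..<s}. (last_visit w q, letter w (last_visit w q)))" for w
  have fin: "finite (visits w q)" for w q by (simp add: visits_def)
  have "sig w \<in> {..<s} \<rightarrow>\<^sub>E {..n} \<times> {..<k}" if w: "w \<in> accepted_words n" for w
  proof -
    have in_visits: "last_visit w q \<in> insert 0 (visits w q)" for q
      unfolding last_visit_def using fin by (intro Max_in) auto
    have "last_visit w q \<le> n" for q using in_visits[of q] by (auto simp: visits_def)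
    moreover have "letter w i < k" for i
    proof (cases "i < n")
      case True
      then have "w ! i \<in> set w" using w by (intro nth_mem) (simp add: accepted_words_def)
      moreover have "set w \<subseteq> {..<k}" using w by (simp add: accepted_words_def)
      ultimately have "w ! i < k" by blast
      then show ?thesis using True by (simp add: letter_def)
    qed (use k in \<open>simp add: letter_def\<close>)
    ultimately show ?thesis by (auto simp: sig_def)
  qed
  then have sub: "sig ` accepted_words n \<subseteq> {..<s} \<rightarrow>\<^sub>E {..n} \<times> {..<k}" by blast
  have "inj_on sig (accepted_words n)"
  proof (rule inj_onI, rule ccontr)
    fix v w assume v: "v \<in> accepted_words n" and w: "w \<in> accepted_words n"
      and sig: "sig v = sig w" and "v \<noteq> w"
    have len: "length v = n" "length w = n" using v w by (auto simp: accepted_words_def)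
    then obtain i where i: "i < n" "v ! i \<noteq> w ! i" "take i v = take i w"
      using nth_mismatch[of v w] \<open>v \<noteq> w\<close> by auto
    define q where "q = st v i"
    have q: "q = st w i" using i by (simp add: q_def st_def)
    have subs: "set (take j v) \<subseteq> {..<k}" "set (drop j v) \<subseteq> {..<k}"
      "set (take j w) \<subseteq> {..<k}" "set (drop j w) \<subseteq> {..<k}" for j
      using v w by (auto simp: accepted_words_def dest: in_set_takeD in_set_dropD)
    have "q < s" unfolding q_def st_def by (rule dfa_run_less[OF subs(1) initial_less])
    then have "(last_visit v q, letter v (last_visit v q)) = (last_visit w q, letter w (last_visit w q))"
      using fun_cong[OF sig, of q] by (simp only: sig_def restrict_apply' lessThan_iff)
    then have eq: "last_visit v q = last_visit w q"
        "letter v (last_visit v q) = letter w (last_visit w q)"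
      unfolding prod.inject by blast+
    define m where "m = last_visit v q"
    have iv: "i \<in> visits v q" "i \<in> visits w q" using i(1) q q_def by (auto simp: visits_def)
    have last_in: "last_visit x q \<in> visits x q" if "i \<in> visits x q" for x
    proof -
      have ne: "visits x q \<noteq> {}" using that by (rule ex_in_conv[THEN iffD1, OF exI])
      have "last_visit x q = Max (visits x q)"
        unfolding last_visit_def Max_insert[OF fin ne] by (rule max_0L)
      then show ?thesis using Max_in[OF fin ne] by (simp only:)
    qed
    have "m \<in> visits v q" unfolding m_def by (rule last_in[OF iv(1)])
    moreover have "m \<in> visits w q" unfolding m_def eq(1) by (rule last_in[OF iv(2)])
    ultimately have m: "m < n" "st v m = q" "st w m = q"
      unfolding visits_def by (simp_all only: mem_Collect_eq)
    have "i \<le> m" unfolding m_def last_visit_def using fin iv(1) by (intro Max_ge) auto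
    moreover have "i \<noteq> m"
    proof
      assume "i = m"
      then have "letter v i = letter w i" using eq by (metis m_def)
      then show False using i by (simp add: letter_def)
    qed
    ultimately have im: "i < m" by simp
    define y where "y x = drop i (take m x)" for x :: "nat list"
    have "take m x = take i x @ y x" for x
      unfolding y_def using im append_take_drop_id[of i "take m x"] by (simp add: min_def)
    then have run_y: "dfa_run A (y x) (st x i) = st x m" for x
      by (simp add: st_def)
    have y0: "y v ! 0 \<noteq> y w ! 0" using i im len m by (simp add: y_def)
    have "double_loop (take i v) (y v) (y w) (drop m v)"
      unfolding double_loop_def
    proof (intro conjI)
      show "set (y v) \<subseteq> {..<k}" "set (y w) \<subseteq> {..<k}"
        using subs(1,3)[of m] by (auto simp: y_def dest: in_set_dropD)
      show "length (y v) = length (y w)" using len by (simp add: y_def)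
      show "y v \<noteq> y w" using y0 by metis
      show "dfa_run A (y v) (dfa_run A (take i v) (initial A)) = dfa_run A (take i v) (initial A)"
        using run_y[of v] unfolding m(2) q_def[symmetric] by (simp only: q_def st_def)
      show "dfa_run A (y w) (dfa_run A (take i v) (initial A)) = dfa_run A (take i v) (initial A)"
        using run_y[of w] unfolding m(3) q[symmetric] by (simp only: q_def st_def)
      have "dfa_run A (take m v @ drop m v) (initial A) = dfa_run A (drop m v) (st v m)"
        by (simp only: st_def fold_append comp_apply)
      then have "dfa_run A (drop m v) (st v m) = dfa_run A v (initial A)"
        by (simp only: append_take_drop_id)
      then show "dfa_run A (drop m v) (dfa_run A (take i v) (initial A)) \<in> set (accepting A)"
        using v unfolding m(2) q_def by (simp add: st_def accepted_words_def)
    qed (use subs in auto)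
    then show False using assms by blast
  qed
  then have "card (accepted_words n) = card (sig ` accepted_words n)" by (simp add: card_image)
  also have "\<dots> \<le> card ({..<s} \<rightarrow>\<^sub>E {..n} \<times> {..<k})"
    by (intro card_mono sub) (simp add: finite_PiE)
  also have "\<dots> = (Suc n * k) ^ s" by (simp add: card_PiE card_cartesian_product)
  finally show ?thesis .
qed

lemma finite_accepted_words: "finite (accepted_words n)"
  by (rule finite_subset[OF _ finite_lists_length_eq[of "{..<k}" n]]) (auto simp: accepted_words_def)

text \<open>Numbers below \<open>2 ^ l\<close> have at most \<open>l\<close> digits, and for each
  length the accepted words are bounded by a polynomial in \<open>l\<close> of degree
  \<open>s\<close>. Summing over the lengths gives the exponent \<open>Suc s\<close> of the
  logarithm.\<close>

lemma sparse_of_no_double_loop: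
  assumes "\<nexists>u y z v. double_loop u y z v"
  shows "sparse S"
proof -
  have bound: "card (S \<inter> {..n}) \<le> Suc l * (Suc l * k) ^ s" if "n < 2 ^ l" for n l
  proof -
    have "expansion k ` (S \<inter> {..n}) \<subseteq> (\<Union>i\<le>l. accepted_words i)"
    proof
      fix w assume "w \<in> expansion k ` (S \<inter> {..n})"
      then obtain m where m: "w = expansion k m" "m \<in> S" "m \<le> n" by auto
      then have "length w \<le> l" using length_expansion_le[OF k, of m l] that by simp
      moreover have "w \<in> accepted_words (length w)"
        using m canonical_expansion_expansion[OF k, of m]
        by (simp add: accepted_words_def mem_iff_expansion canonical_expansion_iff)
      ultimately show "w \<in> (\<Union>i\<le>l. accepted_words i)" by blast
    qed
    moreover have "inj_on (expansion k) (S \<inter> {..n})"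
      by (rule inj_on_inverseI[of _ "word_value k"]) (rule word_value_expansion[OF k])
    ultimately have "card (S \<inter> {..n}) \<le> card (\<Union>i\<le>l. accepted_words i)"
      by (intro card_inj_on_le) (auto simp: finite_accepted_words)
    also have "\<dots> \<le> (\<Sum>i\<le>l. card (accepted_words i))" by (intro card_UN_le) simp
    also have "\<dots> \<le> (\<Sum>i\<le>l. (Suc l * k) ^ s)"
      by (intro sum_mono order_trans[OF card_accepted_words[OF assms]] power_mono mult_le_mono1) auto
    finally show ?thesis by simp
  qed
  have "real (counting S x) \<le> real k ^ s * 4 ^ Suc s * ln x ^ Suc s" if x: "exp 1 \<le> x" for x
  proof -
    have x1: "1 \<le> ln x" "0 < x" using x exp_gt_zero[of "1::real"] by (auto simp: ln_ge_iff simp del: exp_gt_zero)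
    define l where "l = nat \<lfloor>log 2 x\<rfloor> + 1"
    \<comment> \<open>This gives \<open>log 2 x \<le> 2 * ln x\<close>, and hence
      \<open>Suc l \<le> log 2 x + 2 \<le> 4 * ln x\<close> as soon as
      \<open>ln x \<ge> 1\<close>.\<close>
    have "2 * ln 2 \<ge> (1::real)"
      using ln_mono[of "exp (1/2)" "2::real"] exp_half_le2 by simp
    then have "ln x * 1 \<le> ln x * (2 * ln 2)"
      by (intro mult_left_mono) (use x1 in linarith)+
    then have "log 2 x \<le> 2 * ln x" by (simp add: log_def field_simps)
    moreover have "0 \<le> log 2 x" unfolding log_def using x1(1) by (intro divide_nonneg_nonneg) auto
    then have "real l = of_int \<lfloor>log 2 x\<rfloor> + 1" by (simp add: l_def)
    then have l: "log 2 x < real l" "real l \<le> log 2 x + 1" by linarith+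
    ultimately have l4: "real (Suc l) \<le> 4 * ln x" using x1 by simp
    have "x < 2 powr real l" using l(1) x1 by (simp add: less_powr_iff)
    then have "x < 2 ^ l" by (simp add: powr_realpow)
    define n where "n = nat \<lfloor>x\<rfloor>"
    have "real n \<le> x" using x1 by (simp add: n_def)
    then have "real n < 2 ^ l" using \<open>x < 2 ^ l\<close> by linarith
    then have "n < 2 ^ l" by simp
    have "m \<le> n \<longleftrightarrow> real m \<le> x" for m
      using x1(2) unfolding n_def by (simp add: le_nat_iff le_floor_iff)
    then have "{m \<in> S. real m \<le> x} = S \<inter> {..n}" by auto
    then have "real (counting S x) \<le> real (Suc l * (Suc l * k) ^ s)"
      unfolding counting_def using bound[OF \<open>n < 2 ^ l\<close>] by (simp only: of_nat_le_iff)
    also have "\<dots> = real k ^ s * real (Suc l) ^ Suc s"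
      by (simp only: of_nat_mult of_nat_power power_mult_distrib power_Suc mult_ac)
    also have "\<dots> \<le> real k ^ s * (4 * ln x) ^ Suc s"
      using l4 by (intro mult_left_mono power_mono) auto
    finally show ?thesis by (simp add: power_mult_distrib mult_ac)
  qed
  then have "(\<lambda>x. real (counting S x)) \<in> O[at_top](\<lambda>x. ln x ^ Suc s)"
    by (intro bigoI[of _ "real k ^ s * 4 ^ Suc s"] eventually_mono[OF eventually_ge_at_top[of "exp 1"]])
      (auto intro: order_trans[OF _ mult_left_mono[OF abs_ge_self]])
  then show ?thesis unfolding sparse_def by blast
qed

section \<open>Short double loops and an explicit bound on the number of summands\<close>

lemma short_run:
  assumes "set w \<subseteq> {..<k}" "q < s"
  obtains w' where "set w' \<subseteq> {..<k}" "length w' < s" "dfa_run A w' q = dfa_run A w q"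
  using run_shorten[of "{..<s}" "{..<k}" "\<lambda>a q. delta A ! q ! a" w q] assms
  by (auto simp: delta_less)

text \<open>The prefix and the suffix can be shortened independently, but the two loops must keep a
  common length and remain distinct; the bound \<open>2 * s * s\<close> counts pairs of states with
  one bit.\<close>

lemma short_double_loop:
  assumes "double_loop u y z v"
  obtains u' y' z' v' where "double_loop u' y' z' v'"
    "length u' < s" "length y' < 2 * s * s" "length v' < s"
proof -
  define q where "q = dfa_run A u (initial A)"
  have D: "set u \<subseteq> {..<k}" "set y \<subseteq> {..<k}" "set z \<subseteq> {..<k}" "set v \<subseteq> {..<k}"
    "length y = length z" "y \<noteq> z" "dfa_run A y q = q" "dfa_run A z q = q"
    "dfa_run A v q \<in> set (accepting A)"
    using assms by (simp_all add: double_loop_def q_def)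
  have q: "q < s" unfolding q_def by (rule dfa_run_less[OF D(1) initial_less])
  obtain u' where u': "set u' \<subseteq> {..<k}" "length u' < s" "dfa_run A u' (initial A) = q"
    using short_run[OF D(1) initial_less] by (auto simp: q_def)
  obtain v' where v': "set v' \<subseteq> {..<k}" "length v' < s" "dfa_run A v' q = dfa_run A v q"
    using short_run[OF D(4) q] .
  \<comment> \<open>Both loops are run in parallel; the Boolean records whether they have differed.\<close>
  define f where "f = (\<lambda>(a, b) (p, r, e). (delta A ! p ! a, delta A ! r ! b, e \<or> a \<noteq> b))"
  have f: "fold f ps (p, r, e) =
      (dfa_run A (map fst ps) p, dfa_run A (map snd ps) r, e \<or> map fst ps \<noteq> map snd ps)" for ps p r e
    by (induction ps arbitrary: p r e) (auto simp: f_def)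
  let ?X = "{..<s} \<times> {..<s} \<times> (UNIV :: bool set)"
  have "set (zip y z) \<subseteq> {..<k} \<times> {..<k}"
    using D(2,3) by (auto dest: set_zip_leftD set_zip_rightD)
  moreover have "f a x \<in> ?X" if "a \<in> {..<k} \<times> {..<k}" "x \<in> ?X" for a x
    using that by (auto simp: f_def delta_less)
  moreover have "finite ?X" "(q, q, False) \<in> ?X" using q by auto
  ultimately obtain ps where ps: "set ps \<subseteq> {..<k} \<times> {..<k}" "length ps < card ?X"
    "fold f ps (q, q, False) = fold f (zip y z) (q, q, False)"
    using run_shorten[of ?X "{..<k} \<times> {..<k}" f "zip y z" "(q, q, False)"] by blast
  have "double_loop u' (map fst ps) (map snd ps) v'"
    using ps u' v' D by (auto simp: double_loop_def f)
  moreover have "length (map fst ps) < 2 * s * s" using ps(2) by (simp add: card_cartesian_product)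
  ultimately show thesis using that u' v' by blast
qed

lemma double_loop_commute: "double_loop u y z v \<longleftrightarrow> double_loop u z y v"
  by (auto simp: double_loop_def)

text \<open>In a word \<open>u X v\<close> with \<open>X\<close> a sequence of loops, loop number
  \<open>i\<close> starts at position \<open>length u + i * length y\<close>. Taking
  \<open>z\<close> instead of \<open>y\<close> there adds
  \<open>(word_value k z - word_value k y) * k ^ length u * ?K ^ i\<close>. The offset
  \<open>B n\<close> belongs to the word with all loops equal to \<open>y\<close>, and the length of
  that word gives the bound with \<open>k ^ (length u + length v)\<close>.\<close>

lemma double_loop_blocks:
  assumes D: "double_loop u y z v" and less: "word_value k y < word_value k z"
  obtains B where "binary_blocks S B ((word_value k z - word_value k y) * k ^ length u)
    (k ^ length y) (k ^ (length u + length v))"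
proof
  let ?d = "word_value k y" and ?K = "k ^ length y" and ?q = "dfa_run A u (initial A)"
  define c where "c = word_value k z - word_value k y"
  define X where "X e n = concat (map (\<lambda>i. if e i = (0::nat) then y else z) [0..<n])" for e n
  define B where "B n = word_value k (u @ X (\<lambda>_. 0) n @ v)" for n
  note D' = D[unfolded double_loop_def]
  have X_Suc: "X e (Suc n) = X e n @ (if e n = 0 then y else z)" for e n by (simp add: X_def)
  have len: "length (X e n) = length y * n" for e n
    by (induction n) (use D' in \<open>auto simp: X_Suc X_def\<close>)
  have set_X: "set (X e n) \<subseteq> {..<k}" for e n
    by (induction n) (use D' in \<open>auto simp: X_Suc X_def\<close>)
  have run_X: "dfa_run A (X e n) ?q = ?q" for e n
    by (induction n) (use D' in \<open>auto simp: X_Suc X_def\<close>)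
  have val: "word_value k (X e n) = word_value k (X (\<lambda>_. 0) n) + c * (\<Sum>i<n. e i * ?K ^ i)"
    if "\<And>i. e i \<le> 1" for e n
  proof (induction n)
    case (Suc n)
    have "word_value k (if e n = 0 then y else z) = ?d + c * e n"
      using less that[of n] by (auto simp: c_def le_Suc_eq)
    then have "word_value k (X e (Suc n)) = word_value k (X e n) + ?K ^ n * (?d + c * e n)"
      by (simp only: X_Suc word_value_append len power_mult)
    moreover have "word_value k (X (\<lambda>_. 0) (Suc n)) = word_value k (X (\<lambda>_. 0) n) + ?K ^ n * ?d"
      by (simp add: X_Suc word_value_append len power_mult)
    ultimately show ?case using Suc by (simp add: algebra_simps)
  qed (simp add: X_def)
  have mem: "word_value k (u @ X e n @ v) \<in> S" for e n
    using D' set_X run_X by (intro accepted_mem) auto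
  show "binary_blocks S B ((word_value k z - word_value k y) * k ^ length u) ?K (k ^ (length u + length v))"
  proof
    have "y \<noteq> []" using D' by auto
    then show "2 \<le> ?K" using k one_less_power[of k "length y"] by simp
    show "1 \<le> (word_value k z - word_value k y) * k ^ length u" using less k by simp
    show "B n \<le> k ^ (length u + length v) * ?K ^ n" for n
    proof -
      have "B n < k ^ length (u @ X (\<lambda>_. 0) n @ v)"
        unfolding B_def using D' set_X[of "\<lambda>_. 0" n] by (intro word_value_less) auto
      also have "\<dots> = k ^ (length u + length v) * ?K ^ n"
        unfolding length_append len power_add power_mult by (simp only: mult_ac)
      finally show ?thesis by simp
    qed
    fix n and e :: "nat \<Rightarrow> nat" assume e: "\<And>i. e i \<le> 1"
    have "word_value k (u @ X e n @ v) = B n + c * k ^ length u * (\<Sum>i<n. e i * ?K ^ i)"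
      unfolding B_def word_value_append val[OF e] len by (simp add: algebra_simps)
    then show "B n + (word_value k z - word_value k y) * k ^ length u * (\<Sum>i<n. e i * ?K ^ i) \<in> S"
      using mem[of e n] by (simp add: c_def)
  qed
qed

lemma non_sparse_basis:
  assumes "\<not> sparse S" "Gcd S = 1"
  obtains N M where "basis_from S N M" "N \<le> summands_bound k (enc (table_of A))"
proof -
  let ?a = "enc (table_of A)"
  define Z where "Z = k ^ (2 * ?a * ?a + 2 * ?a)"
  have sa: "s \<le> ?a" by (rule states_le_code)
  obtain u y z v where D: "double_loop u y z v" and
    short: "length u < s" "length y < 2 * s * s" "length v < s"
    using sparse_of_no_double_loop assms(1) short_double_loop by metis
  \<comment> \<open>Distinct words of equal length have distinct values, so after a possible swap of
    the loops \<open>?E\<close> is positive.\<close>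
  have "word_value k y \<noteq> word_value k z"
    using D word_value_inj[of y z k] by (auto simp: double_loop_def)
  then obtain y z where D: "double_loop u y z v" and less: "word_value k y < word_value k z"
    and y: "length y < 2 * s * s"
    using D short(2) double_loop_commute by (metis double_loop_def linorder_neqE_nat)
  let ?E = "(word_value k z - word_value k y) * k ^ length u" and ?K = "k ^ length y"
    and ?C = "k ^ (length u + length v)"
  obtain B where "binary_blocks S B ?E ?K ?C" using double_loop_blocks[OF D less] .
  then interpret binary_blocks S B ?E ?K ?C .
  have C: "1 \<le> ?C" using k by simp
  have "2 * s * s \<le> 2 * ?a * ?a" using sa by (intro mult_le_mono) auto
  then have yl: "length y \<le> 2 * ?a * ?a" using y by linarith
  have "word_value k z < k ^ length y"
    using D word_value_less[of z k] by (simp add: double_loop_def)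
  then have "?E \<le> ?K * k ^ length u" by (intro mult_le_mono1) simp
  also have "\<dots> = k ^ (length y + length u)" by (simp add: power_add)
  also have "\<dots> \<le> Z" unfolding Z_def using k yl short sa by (intro power_increasing) auto
  finally have EZ: "?E \<le> Z" .
  have KZ: "?K \<le> Z" unfolding Z_def using k yl by (intro power_increasing) auto
  have CZ: "?C \<le> Z" unfolding Z_def using k short sa by (intro power_increasing) auto
  have "1 \<le> H" using E K by (simp add: H_def)
  moreover have "1 \<le> J" using C K by (simp add: J_def)
  ultimately have "1 \<le> J * H" by simp
  from basis_from_multiples[OF assms(2) E this multiples[OF C]]
  obtain M where M: "basis_from S (J * H + ?E) M" by blast
  \<comment> \<open>Apart from the 2, the product \<open>J * H\<close> has the five factors
    \<open>?K - 1\<close>, \<open>?C\<close>, \<open>?K\<close>, \<open>?E\<close>,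
    \<open>?K - 1\<close>, each at most \<open>Z\<close>; this is the exponent 5 in
    \<open>summands_bound\<close>. The summand \<open>?E\<close> pays for adjusting the
    residue.\<close>
  have five: "2 * b * c * d * e * f \<le> 2 * Z * Z * Z * Z * Z"
    if "b \<le> Z" "c \<le> Z" "d \<le> Z" "e \<le> Z" "f \<le> Z" for b c d e f
    using that by (intro mult_le_mono order_refl)
  have "J * H = 2 * (?K - 1) * ?C * ?K * ?E * (?K - 1)" by (simp add: J_def H_def)
  also have "\<dots> \<le> 2 * Z * Z * Z * Z * Z"
    using EZ KZ CZ by (intro five) auto
  also have "\<dots> = 2 * (Z * Z * Z * Z * Z)" by (simp only: mult.assoc)
  also have "Z * Z * Z * Z * Z = Z ^ 5" by (simp add: eval_nat_numeral)
  finally have "J * H + ?E \<le> summands_bound k ?a"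
    using EZ unfolding summands_bound_def Z_def[symmetric] by linarith
  then show thesis using that M by blast
qed

section \<open>Correctness of the answer\<close>

lemma answer_correct:
  "if \<not> sparse S \<and> Gcd S = 1
   then \<exists>N M. optimal_basis_from S N M \<and> answer k (table_of A) = answer_code (Some (N, M))
   else answer k (table_of A) = answer_code None"
proof -
  let ?bound = "summands_bound k (enc (table_of A))" and ?N = "least_summands k (table_of A)"
  have N: "?N = (LEAST N. ?bound < N \<or> (\<exists>M. basis_from S N M))"
    by (simp add: least_summands_def basis_from_iff_test(2))
  show ?thesis
  proof (cases "\<not> sparse S \<and> Gcd S = 1")
    case True
    then obtain N0 M0 where N0: "basis_from S N0 M0" "N0 \<le> ?bound"
      using non_sparse_basis by metis
    then have le: "?N \<le> ?bound" unfolding N by (metis (mono_tags, lifting) Least_le order_trans)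
    have "?bound < ?N \<or> (\<exists>M. basis_from S ?N M)"
      unfolding N by (rule LeastI_ex) (use N0 in blast)
    then have basis: "\<exists>M. basis_from S ?N M" using le by simp
    define M where "M = (LEAST M. basis_from S ?N M)"
    have "optimal_basis_from S ?N M"
      unfolding optimal_basis_from_def
    proof (intro conjI allI impI)
      show "basis_from S ?N M" unfolding M_def using basis by (rule LeastI_ex)
      show "?N \<le> N'" if "basis_from S N' M'" for N' M'
        unfolding N by (rule Least_le) (use that in blast)
      show "M \<le> M'" if "basis_from S ?N M'" for M' unfolding M_def using that by (rule Least_le)
    qed
    moreover have "basis_from S ?N = basis_test k (table_of A) ?N"
      using basis basis_from_iff_test(1) by blast
    then have "answer k (table_of A) = answer_code (Some (?N, M))"
      using le by (simp add: answer_def M_def)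
    ultimately show ?thesis using True by metis
  next
    case False
    then have "(\<exists>M. basis_from S N M) \<longleftrightarrow> False" for N
      using basis_from_Gcd basis_from_not_sparse by blast
    \<comment> \<open>No basis exists for any \<open>N\<close>, so only the limit ends the search,
      and the result lies above it.\<close>
    then have "?N = (LEAST N. ?bound < N)" unfolding N by (simp only: simp_thms)
    then have "?bound < ?N" by (metis LeastI lessI)
    then show ?thesis using False by (simp add: answer_def)
  qed
qed

end

theorem theorem1p2:
  "\<exists>p :: recf. \<forall>(k::nat) (A::dfa) (S::nat set). 2 \<le> k \<longrightarrow> automaton_for k A S \<longrightarrow>
     (if \<not> sparse S \<and> Gcd S = 1
      then \<exists>N M. optimal_basis_from S N M \<and> computes p [k, dfa_code A] (answer_code (Some (N, M)))
      else computes p [k, dfa_code A] (answer_code None))"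
proof -
  obtain p where p: "\<And>k A. computes p [k, dfa_code A] (answer k (table_of A))"
    using answer_computes by blast
  show ?thesis
  proof (intro exI[of _ p] allI impI)
    fix k A S assume "2 \<le> k" "automaton_for k A S"
    then interpret automatic_set k A S by unfold_locales
    show "if \<not> sparse S \<and> Gcd S = 1
      then \<exists>N M. optimal_basis_from S N M \<and> computes p [k, dfa_code A] (answer_code (Some (N, M)))
      else computes p [k, dfa_code A] (answer_code None)"
    proof (cases "\<not> sparse S \<and> Gcd S = 1")
      case True
      then obtain N M where "optimal_basis_from S N M"
          "answer k (table_of A) = answer_code (Some (N, M))"
        using answer_correct unfolding if_P[OF True] by blast
      then have "optimal_basis_from S N M \<and> computes p [k, dfa_code A] (answer_code (Some (N, M)))"
        using p[of k A] by metis
      then show ?thesis unfolding if_P[OF True] by blast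
    next
      case False
      show ?thesis using answer_correct p[of k A] unfolding if_not_P[OF False] by simp
    qed
  qed
qed

end
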